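(* Suppose that: (1) the action space $\mathcal{A}$ is compact; (2) for every $s\in\mathcal{S}$ and every Borel set $B\in\mathcal{B}(\mathcal{S})$ the map $a\mapsto P(B\mid s,a)$ is continuous, and for every $s\in\mathcal S$ and $t\in\{0,\dots,H-1\}$ the map $a\mapsto r_t(s,a)$ is continuous; (3) there exist a policy $\pi_0\in\Pi$ and a constant $\nu_s>0$ with $P_{s_0}^{\pi_0}(\mathcal{C}_{\mathcal{K},\mathcal{G}})\ge\delta+\nu_s$. Then there exists a Markov policy $\tilde\pi_M^*\in\tilde\Pi_M$ which is optimal for the augmented problem $$\sup_{\tilde\pi\in\tilde\Pi}V_{r,0}^{\tilde\pi}(\tilde s_0)\quad\text{s.t.}\quad V_{c,0}^{\tilde\pi}(\tilde s_0)\ge\delta ,$$ and such that the (in general non-Markovian) policy $g(\tilde\pi_M^* )\in\Pi$ is optimal for the original problem $$\sup_{\pi\in\Pi}V_{r,0}^{\pi}(s_0)\quad\text{s.t.}\quad P_{s_0}^{\pi}(\mathcal{C}_{\mathcal{K},\mathcal{G}})\ge\delta ;$$ that is, $P_{s_0}^{g(\tilde\pi_M^* )}(\mathcal{C}_{\mathcal{K},\mathcal{G}})\ge\delta$ and $V_{r,0}^{\pi^*}(s_0)=V_{r,0}^{g(\tilde\pi_M^* )}(s_0)$, where $\pi^*$ is an optimal policy for the original problem.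
   Context: Notation: for $m\in\mathbb N$, $[m]=\{0,1,\dots,m\}$ (and $[-1]=\emptyset$); $\mathcal B(\cdot)$ is the Borel $\sigma$-algebra; $\mathbf 1$ denotes an indicator. Original MDP. $\mathcal S$ (states) and $\mathcal A$ (actions) are Borel subsets of complete separable metric spaces; $H\in\mathbb N$ is the horizon; $P(\cdot\mid s,a)$ is the transition kernel from $\mathcal S\times\mathcal A$ to $\mathcal S$; rewards are measurable functions $r_t:\mathcal S\times\mathcal A\to[0,1]$ for $t\in[H-1]$ and a terminal reward $r_H:\mathcal S\to[0,1]$. Histories: $\mathbb H_0=\mathcal S$, $\mathbb H_t=(\mathcal S\times\mathcal A)^t\times\mathcal S$, with elements $h_t=(s_0,a_0,\dots,s_{t-1},a_{t-1},s_t)$. A policy $\pi=\{\pi_t\}_{t\in[H-1]}$ is a sequence of Borel-measurable stochastic kernels $\pi_t(\cdot\mid h_t)$ on $\mathcal A$ given $h_t\in\mathbb H_t$; it is Markov if each $\pi_t(\cdot\mid h_t)=\pi_t(\cdot\mid s_t)$ depends only on the current state. $\Pi$ is the set of all policies. The initial state $s_0\in\mathcal S$ is fixed; $P^\pi_{s_0}$ is the resulting law on $\mathbb H_H$, with expectation $\mathbb E^\pi$, and $V_{r,0}^\pi(s_0)=\mathbb E^\pi[\sum_{i=0}^{H-1}r_i(s_i,a_i)+r_H(s_H)]$. Reach-avoid. $\mathcal K,\mathcal G\in\mathcal B(\mathcal S)$ with $\mathcal G\subset\mathcal K$ are the safe and goal sets, and $\mathcal C_{\mathcal K,\mathcal G}=\{\tau\in\mathbb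 H_H:\exists t\in[H],\ s_t\in\mathcal G,\ s_i\in\mathcal K\setminus\mathcal G\ \forall i\in[t-1]\}$. The threshold $\delta\in[0,1)$ is fixed. Augmented constrained MDP. $\mathcal Y=\{0,1,2\}$, $\tilde{\mathcal S}=\mathcal S\times\mathcal Y$, with elements $\tilde s=(s,y)$. Define $f:\mathcal S\times\mathcal Y\to\mathcal Y$ by $f(s,y)=2$ if $y=2$ or ($y=1$ and $s\in\mathcal G$); $f(s,y)=1$ if $y=1$ and $s\in\mathcal K\setminus\mathcal G$; $f(s,y)=0$ otherwise. The augmented transition kernel $\tilde P$ is: given $(s_t,y_t)$ and $a_t$, draw $s_{t+1}\sim P(\cdot\mid s_t,a_t)$ and set $y_{t+1}=f(s_{t+1},y_t)$. Horizon, actions and rewards $r$ (functions of $s$ and $a$ only) are as in the original MDP; the terminal constraint function is $c(\tilde s)=\mathbf 1_{y=2}$ for $\tilde s=(s,y)$. The initial augmented state is $\tilde s_0=(s_0,\mathbf 1_{s_0\in\mathcal K\setminus\mathcal G}+2\cdot\mathbf 1_{s_0\in\mathcal G})$. $\tilde\Pi$ is the set of all (history-dependent) policies on $\tilde{\mathcal S}$, i.e. of all sequences $\tilde\pi=\{\tilde\pi_t\}_{t\in[H-1]}$ of Borel-measurable stochastic kernels $\tilde\pi_t(\cdot\mid\tilde h_t)$ on $\mathcal A$ given augmented histories $\tilde h_t=(\tilde s_0,a_0,\dots,\tilde s_{t-1},a_{t-1},\tilde s_t)\in(\tilde{\mathcal S}\times\mathcal A)^t\times\tilde{\mathcal S}$;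 $\tilde\Pi_M\subset\tilde\Pi$ is the set of Markov policies $\{\tilde\pi_t(\cdot\mid s_t,y_t)\}_{t\in[H-1]}$ on $\tilde{\mathcal S}$, i.e. those for which each $\tilde\pi_t(\cdot\mid\tilde h_t)=\tilde\pi_t(\cdot\mid s_t,y_t)$ depends only on the current augmented state $\tilde s_t=(s_t,y_t)$. For $\tilde\pi\in\tilde\Pi$, started at $\tilde s_0$, $V_{r,0}^{\tilde\pi}(\tilde s_0)=\mathbb E^{\tilde\pi}[\sum_{i=0}^{H-1}r_i(s_i,a_i)+r_H(s_H)]$ and $V_{c,0}^{\tilde\pi}(\tilde s_0)=\mathbb E^{\tilde\pi}[c(\tilde s_H)]$. The map $g:\tilde\Pi_M\to\Pi$. For a history $h_t=(s_0,a_0,\dots,s_t)$ define recursively $b_0=\mathbf 1_{s_0\in\mathcal K\setminus\mathcal G}+2\cdot\mathbf 1_{s_0\in\mathcal G}$ and $b_t=f(s_t,b_{t-1})$ for $t\in\{1,\dots,H-1\}$. For $\tilde\pi\in\tilde\Pi_M$, $g(\tilde\pi)$ is the policy $\pi$ with $\pi_t(\cdot\mid h_t)=\tilde\pi_t(\cdot\mid s_t,b_t)$ for all $t\in[H-1]$. A policy is optimal for a constrained problem if it satisfies the constraint and attains the supremum. *)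

theory Defs
  imports "HOL-Probability.Probability"
begin

section \<open>Finite-horizon Markov decision processes\<close>

text \<open>
  The state and action spaces are given as measurable spaces \<open>M\<close> and \<open>N\<close>, so that the
  same definitions serve the original and the augmented process. Kernels are measurable maps into
  \<^const>\<open>prob_algebra\<close>. Only the entries \<open>t < H\<close> of a policy and of a reward sequence are relevant.
\<close>

abbreviation borel_on :: "'a::topological_space set \<Rightarrow> 'a measure" where
  "borel_on X \<equiv> restrict_space borel X"

text \<open>
  A history \<open>(s\<^sub>0, a\<^sub>0, \<dots>, s\<^sub>t\<^sub>-\<^sub>1, a\<^sub>t\<^sub>-\<^sub>1, s\<^sub>t)\<close> is the pair \<open>(w, s\<^sub>t)\<close> with
  \<open>w i = (s\<^sub>i, a\<^sub>i)\<close> for \<open>i < t\<close> and \<open>w i = undefined\<close> for \<open>i \<ge> t\<close>.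
\<close>

type_synonym ('s, 'a) history = "(nat \<Rightarrow> 's \<times> 'a) \<times> 's"

definition history_space :: "'s measure \<Rightarrow> 'a measure \<Rightarrow> nat \<Rightarrow> ('s, 'a) history measure" where
  "history_space M N t = (\<Pi>\<^sub>M i\<in>{..<t}. M \<Otimes>\<^sub>M N) \<Otimes>\<^sub>M M"

definition state_at :: "nat \<Rightarrow> ('s, 'a) history \<Rightarrow> nat \<Rightarrow> 's" where
  "state_at t h i = (if i < t then fst (fst h i) else snd h)"

type_synonym ('s, 'a) policy = "nat \<Rightarrow> ('s, 'a) history \<Rightarrow> 'a measure"

definition policies :: "'s measure \<Rightarrow> 'a measure \<Rightarrow> nat \<Rightarrow> ('s, 'a) policy set" where
  "policies M N H =
     {\<pi>. \<forall>t<H. \<pi> t \<in> history_space M N t \<rightarrow>\<^sub>M prob_algebra N}"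

definition markov_policies :: "'s measure \<Rightarrow> 'a measure \<Rightarrow> nat \<Rightarrow> ('s, 'a) policy set" where
  "markov_policies M N H =
     {\<pi> \<in> policies M N H. \<forall>t<H. \<forall>h\<in>space (history_space M N t).
        \<forall>h'\<in>space (history_space M N t). snd h = snd h' \<longrightarrow> \<pi> t h = \<pi> t h'}"

text \<open>For a Markov policy \<open>\<pi>\<close>, the action distribution \<open>\<pi>\<^sub>t(\<cdot> | x)\<close> at the current state \<open>x\<close>.\<close>

definition markov_kernel ::
    "'s measure \<Rightarrow> 'a measure \<Rightarrow> ('s, 'a) policy \<Rightarrow> nat \<Rightarrow> 's \<Rightarrow> 'a measure" where
  "markov_kernel M N \<pi> t x =
     (THE \<kappa>. \<forall>h\<in>space (history_space M N t). snd h = x \<longrightarrow> \<pi> t h = \<kappa>)"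

text \<open>The law of the length-\<open>t\<close> history under \<open>\<pi>\<close>, started at \<open>s\<^sub>0\<close>.\<close>

primrec history_law ::
    "'s measure \<Rightarrow> 'a measure \<Rightarrow> ('s \<times> 'a \<Rightarrow> 's measure) \<Rightarrow> 's \<Rightarrow> ('s, 'a) policy
      \<Rightarrow> nat \<Rightarrow> ('s, 'a) history measure" where
  "history_law M N P s\<^sub>0 \<pi> 0 = return (history_space M N 0) (\<lambda>_. undefined, s\<^sub>0)"
| "history_law M N P s\<^sub>0 \<pi> (Suc t) =
     bind (history_law M N P s\<^sub>0 \<pi> t) (\<lambda>h.
       bind (\<pi> t h) (\<lambda>a.
         distr (P (snd h, a)) (history_space M N (Suc t))
           (\<lambda>s'. ((fst h)(t := (snd h, a)), s'))))"

definition reward_value ::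
    "'s measure \<Rightarrow> 'a measure \<Rightarrow> ('s \<times> 'a \<Rightarrow> 's measure) \<Rightarrow> nat
      \<Rightarrow> (nat \<Rightarrow> 's \<times> 'a \<Rightarrow> real) \<Rightarrow> ('s \<Rightarrow> real) \<Rightarrow> 's \<Rightarrow> ('s, 'a) policy \<Rightarrow> real" where
  "reward_value M N P H r r\<^sub>H s\<^sub>0 \<pi> =
     (\<integral>h. (\<Sum>i<H. r i (fst h i)) + r\<^sub>H (snd h) \<partial>history_law M N P s\<^sub>0 \<pi> H)"

definition terminal_value ::
    "'s measure \<Rightarrow> 'a measure \<Rightarrow> ('s \<times> 'a \<Rightarrow> 's measure) \<Rightarrow> nat
      \<Rightarrow> ('s \<Rightarrow> real) \<Rightarrow> 's \<Rightarrow> ('s, 'a) policy \<Rightarrow> real" where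
  "terminal_value M N P H c s\<^sub>0 \<pi> = (\<integral>h. c (snd h) \<partial>history_law M N P s\<^sub>0 \<pi> H)"

text \<open>
  \<open>x\<close> is optimal for \<open>sup {V x | x \<in> X}\<close> subject to \<open>C x \<ge> \<delta>\<close>. The supremum is taken in the
  reals; for the problems below \<open>V\<close> takes values in \<open>[0, H + 1]\<close>, so it is a genuine supremum.
\<close>

definition constrained_optimal ::
    "'x set \<Rightarrow> ('x \<Rightarrow> real) \<Rightarrow> ('x \<Rightarrow> real) \<Rightarrow> real \<Rightarrow> 'x \<Rightarrow> bool" where
  "constrained_optimal X V C \<delta> x \<longleftrightarrow>
     x \<in> X \<and> C x \<ge> \<delta> \<and> V x = (SUP x'\<in>{x' \<in> X. C x' \<ge> \<delta>}. V x')"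


section \<open>Reach-avoid specifications and the augmented process\<close>

definition reach_avoid ::
    "'s measure \<Rightarrow> 'a measure \<Rightarrow> nat \<Rightarrow> 's set \<Rightarrow> 's set \<Rightarrow> ('s, 'a) history set" where
  "reach_avoid M N H K G =
     {\<tau> \<in> space (history_space M N H).
        \<exists>t\<le>H. state_at H \<tau> t \<in> G \<and> (\<forall>i<t. state_at H \<tau> i \<in> K - G)}"

definition reach_avoid_prob ::
    "'s measure \<Rightarrow> 'a measure \<Rightarrow> ('s \<times> 'a \<Rightarrow> 's measure) \<Rightarrow> nat \<Rightarrow> 's set \<Rightarrow> 's set \<Rightarrow> 's
      \<Rightarrow> ('s, 'a) policy \<Rightarrow> real" where
  "reach_avoid_prob M N P H K G s\<^sub>0 \<pi> =
     measure (history_law M N P s\<^sub>0 \<pi> H) (reach_avoid M N H K G)"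

definition flag_step :: "'s set \<Rightarrow> 's set \<Rightarrow> 's \<Rightarrow> nat \<Rightarrow> nat" where
  "flag_step K G s y =
     (if y = 2 \<or> (y = 1 \<and> s \<in> G) then 2 else if y = 1 \<and> s \<in> K - G then 1 else 0)"

definition flag_init :: "'s set \<Rightarrow> 's set \<Rightarrow> 's \<Rightarrow> nat" where
  "flag_init K G s = indicator (K - G) s + 2 * indicator G s"

primrec flag :: "'s set \<Rightarrow> 's set \<Rightarrow> (nat \<Rightarrow> 's) \<Rightarrow> nat \<Rightarrow> nat" where
  "flag K G x 0 = flag_init K G (x 0)"
| "flag K G x (Suc t) = flag_step K G (x (Suc t)) (flag K G x t)"

definition aug_space :: "'s measure \<Rightarrow> ('s \<times> nat) measure" where
  "aug_space M = M \<Otimes>\<^sub>M count_space {0, 1, 2}"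

definition aug_kernel ::
    "'s measure \<Rightarrow> ('s \<times> 'a \<Rightarrow> 's measure) \<Rightarrow> 's set \<Rightarrow> 's set
      \<Rightarrow> ('s \<times> nat) \<times> 'a \<Rightarrow> ('s \<times> nat) measure" where
  "aug_kernel M P K G = (\<lambda>((s, y), a).
     distr (P (s, a)) (aug_space M) (\<lambda>s'. (s', flag_step K G s' y)))"

definition aug_init :: "'s set \<Rightarrow> 's set \<Rightarrow> 's \<Rightarrow> 's \<times> nat" where
  "aug_init K G s\<^sub>0 = (s\<^sub>0, flag_init K G s\<^sub>0)"

definition aug_reward :: "(nat \<Rightarrow> 's \<times> 'a \<Rightarrow> real) \<Rightarrow> nat \<Rightarrow> ('s \<times> nat) \<times> 'a \<Rightarrow> real" where
  "aug_reward r t = (\<lambda>((s, y), a). r t (s, a))"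

definition aug_terminal_reward :: "('s \<Rightarrow> real) \<Rightarrow> 's \<times> nat \<Rightarrow> real" where
  "aug_terminal_reward r\<^sub>H = (\<lambda>(s, y). r\<^sub>H s)"

definition aug_constraint :: "'s \<times> nat \<Rightarrow> real" where
  "aug_constraint = (\<lambda>(s, y). if y = 2 then 1 else 0)"

text \<open>The map \<open>g\<close> from Markov policies of the augmented process to policies of the original one.\<close>

definition deaugment ::
    "'s measure \<Rightarrow> 'a measure \<Rightarrow> 's set \<Rightarrow> 's set \<Rightarrow> ('s \<times> nat, 'a) policy \<Rightarrow> ('s, 'a) policy" where
  "deaugment M N K G \<pi> t h =
     markov_kernel (aug_space M) N \<pi> t (snd h, flag K G (state_at t h) t)"

definition optimal_original ::
    "'s measure \<Rightarrow> 'a measure \<Rightarrow> ('s \<times> 'a \<Rightarrow> 's measure) \<Rightarrow> nat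
      \<Rightarrow> (nat \<Rightarrow> 's \<times> 'a \<Rightarrow> real) \<Rightarrow> ('s \<Rightarrow> real) \<Rightarrow> 's set \<Rightarrow> 's set \<Rightarrow> real \<Rightarrow> 's
      \<Rightarrow> ('s, 'a) policy \<Rightarrow> bool" where
  "optimal_original M N P H r r\<^sub>H K G \<delta> s\<^sub>0 =
     constrained_optimal (policies M N H)
       (reward_value M N P H r r\<^sub>H s\<^sub>0)
       (reach_avoid_prob M N P H K G s\<^sub>0) \<delta>"

definition optimal_augmented ::
    "'s measure \<Rightarrow> 'a measure \<Rightarrow> ('s \<times> 'a \<Rightarrow> 's measure) \<Rightarrow> nat
      \<Rightarrow> (nat \<Rightarrow> 's \<times> 'a \<Rightarrow> real) \<Rightarrow> ('s \<Rightarrow> real) \<Rightarrow> 's set \<Rightarrow> 's set \<Rightarrow> real \<Rightarrow> 's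
      \<Rightarrow> ('s \<times> nat, 'a) policy \<Rightarrow> bool" where
  "optimal_augmented M N P H r r\<^sub>H K G \<delta> s\<^sub>0 =
     constrained_optimal (policies (aug_space M) N H)
       (reward_value (aug_space M) N (aug_kernel M P K G) H
          (aug_reward r) (aug_terminal_reward r\<^sub>H) (aug_init K G s\<^sub>0))
       (terminal_value (aug_space M) N (aug_kernel M P K G) H
          aug_constraint (aug_init K G s\<^sub>0)) \<delta>"

end

theory Submission
  imports Defs
begin

text \<open>
  For a multiplier \<open>\<beta>\<close>, the Lagrangian \<open>V\<^sub>r + \<beta> V\<^sub>c\<close> of the augmented problem is an unconstrained
  finite-horizon problem, solved by dynamic programming: setwise continuity in the action makes every
  one-step value continuous on the compact action set. The Slater condition makes the dual function
  coercive, so it has a minimiser \<open>\<beta> \<ge> 0\<close>. The right derivative at \<open>\<beta>\<close> of the optimal Lagrangian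
  value is the value of \<open>c\<close> obtained by maximising \<open>c\<close> lexicographically among the optimal actions of
  every stage, and the left derivative is obtained by minimising it. Minimality of \<open>\<beta>\<close> then gives two
  deterministic Markov policies, optimal for the Lagrangian, with \<open>V\<^sub>c \<ge> \<delta>\<close> and, if \<open>\<beta> > 0\<close>, \<open>V\<^sub>c \<le> \<delta>\<close>.
  Randomising between them with the same probability at every state and stage keeps the policy Markov
  and optimal for the Lagrangian, and moves \<open>V\<^sub>c\<close> continuously, so some mixture satisfies complementary
  slackness. Finally, the law of an augmented history is the image of the law of the original one
  whenever the two policies agree along the map that records the flags.
\<close>

section \<open>Maximisation over a compact set\<close>

text \<open>The kernel is continuous in the action but only measurable in the state, so compactness
  is used one state at a time, in the action set, and never on a space of policies. The price is
  that ties matter: a Lagrangian-optimal policy may miss complementary slackness, because its value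
  of \<open>c\<close> depends on how ties between optimal actions are broken. Minimality of \<beta>
  controls precisely the two extreme ways of breaking them. The difference quotient of the optimal
  value in \<beta> solves a Bellman equation of its own, whose stage reward is n times the
  nonpositive loss of an action, n being the inverse step; as n grows, actions that are not optimal
  are priced out and the lexicographic problem remains. A single coin tossed at time 0 would also
  reach every intermediate value of \<open>c\<close>, but its outcome would have to be remembered,
  which a Markov policy cannot do. A fresh coin at each stage makes \<open>c\<close> depend on the
  probability in a nonlinear way, whence the intermediate value theorem.\<close>

lemma compact_decseq_nonempty:
  fixes F :: "nat \<Rightarrow> 'a::t2_space set"
  assumes F: "\<And>n. compact (F n)" "\<And>n. F n \<noteq> {}" and mono: "\<And>m n. m \<le> n \<Longrightarrow> F n \<subseteq> F m"
  shows "\<Inter> (range F) \<noteq> {}"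
proof -
  have "F 0 \<inter> (\<Inter>n\<in>UNIV. F n) \<noteq> {}"
  proof (rule compact_imp_fip_image[OF F(1)])
    show "closed (F n)" for n using F(1) by (rule compact_imp_closed)
    fix I :: "nat set" assume I: "finite I" "I \<subseteq> UNIV"
    have "F (Max (insert 0 I)) \<subseteq> F 0 \<inter> (\<Inter>n\<in>I. F n)"
      using I by (intro Int_greatest INT_greatest mono Max_ge) auto
    then show "F 0 \<inter> (\<Inter>n\<in>I. F n) \<noteq> {}" using F(2) by blast
  qed
  then show ?thesis by auto
qed

lemma compact_level_set:
  fixes f :: "'a::t2_space \<Rightarrow> 'b::t1_space"
  assumes "compact A" "continuous_on A f"
  shows "compact {a \<in> A. f a = c}"
proof -
  have "closedin (top_of_set A) (A \<inter> f -` {c})"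
    by (rule continuous_closedin_preimage[OF assms(2)]) simp
  moreover have "A \<inter> f -` {c} = {a \<in> A. f a = c}" by auto
  ultimately show ?thesis using closedin_compact[OF assms(1)] by metis
qed

text \<open>A penalty argument. Since \<open>g\<close> is nonpositive, the weight
  \<open>real n\<close> leaves only its zeros in the limit, and decreasing functions on a compact
  set let the supremum pass to the limit as in Dini's theorem. It serves two ends: measurability of
  a supremum over a set that varies with a parameter, and the limit of the difference quotients of
  the optimal value.\<close>

lemma penalized_sup_tendsto:
  fixes g :: "'a::t2_space \<Rightarrow> real"
  assumes A: "compact A"
    and g: "continuous_on A g" "\<And>a. a \<in> A \<Longrightarrow> g a \<le> 0" "\<exists>a\<in>A. g a = 0"
    and \<psi>: "\<And>n. continuous_on A (\<psi> n)" "\<And>n a. a \<in> A \<Longrightarrow> \<psi> (Suc n) a \<le> \<psi> n a"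
      "\<And>a. a \<in> A \<Longrightarrow> (\<lambda>n. \<psi> n a) \<longlonglongrightarrow> \<psi>' a"
  shows "(\<lambda>n. SUP a\<in>A. real n * g a + \<psi> n a) \<longlonglongrightarrow> (SUP a\<in>{a \<in> A. g a = 0}. \<psi>' a :: real)"
proof -
  define \<theta> where "\<theta> n a = real n * g a + \<psi> n a" for n a
  let ?Z = "{a \<in> A. g a = 0}"
  have ne: "A \<noteq> {}" "?Z \<noteq> {}" using g(3) by auto
  have cont: "continuous_on A (\<theta> n)" for n
    unfolding \<theta>_def by (intro continuous_intros g \<psi>)
  have bdd: "bdd_above (\<theta> n ` A)" for n
    using compact_continuous_image[OF cont A] by (intro bounded_imp_bdd_above compact_imp_bounded)
  have dec: "\<theta> (Suc n) a \<le> \<theta> n a" if "a \<in> A" for n a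
    unfolding \<theta>_def using g(2)[OF that] \<psi>(2)[OF that, of n] by (simp add: algebra_simps)
  have dec': "\<theta> m a \<le> \<theta> n a" if "a \<in> A" "n \<le> m" for n m a
    by (rule lift_Suc_antimono_le[of "\<lambda>n. \<theta> n a", OF dec[OF that(1)] that(2)])
  have lim_le: "\<psi>' a \<le> \<psi> n a" if "a \<in> A" for n a
    by (rule decseq_ge[OF decseq_SucI \<psi>(3)]) (use \<psi>(2) that in auto)
  have le_SUP: "\<theta> n a \<le> (SUP a\<in>A. \<theta> n a)" if "a \<in> A" for n a
    by (rule cSUP_upper[OF that bdd])
  have bddZ: "bdd_above (\<psi>' ` ?Z)"
  proof (rule bdd_aboveI2)
    fix a assume "a \<in> ?Z"
    then show "\<psi>' a \<le> (SUP a\<in>A. \<theta> 0 a)"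
      using lim_le[of a 0] le_SUP[of a 0] by (simp add: \<theta>_def)
  qed
  have lower: "(SUP a\<in>?Z. \<psi>' a) \<le> (SUP a\<in>A. \<theta> n a)" for n
  proof (rule cSUP_least[OF ne(2)])
    fix a assume a: "a \<in> ?Z"
    then have "\<psi>' a \<le> \<theta> n a" using lim_le[of a n] by (simp add: \<theta>_def)
    also have "\<dots> \<le> (SUP a\<in>A. \<theta> n a)" using le_SUP a by auto
    finally show "\<psi>' a \<le> (SUP a\<in>A. \<theta> n a)" .
  qed
  have upper: "\<exists>n. (SUP a\<in>A. \<theta> n a) < y" if y: "(SUP a\<in>?Z. \<psi>' a) < y" for y
  proof (rule ccontr)
    assume *: "\<not> (\<exists>n. (SUP a\<in>A. \<theta> n a) < y)"
    \<comment> \<open>If every supremum is at least \<open>y\<close>, these superlevel sets are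
      nonempty, compact and nested; a common point then contradicts the choice of
      \<open>y\<close>.\<close>
    define F where "F n = {a \<in> A. \<theta> n a \<ge> y}" for n
    have "\<Inter> (range F) \<noteq> {}"
    proof (rule compact_decseq_nonempty)
      fix n
      show "compact (F n)"
        using continuous_closedin_preimage[OF cont[of n], of "{y..}"] closedin_compact[OF A]
        by (auto simp: F_def vimage_def Int_def)
      obtain a where a: "a \<in> A" "\<forall>b\<in>A. \<theta> n b \<le> \<theta> n a"
        using continuous_attains_sup[OF A ne(1) cont] by blast
      have "(SUP a\<in>A. \<theta> n a) \<le> \<theta> n a" by (rule cSUP_least[OF ne(1)]) (use a in auto)
      then show "F n \<noteq> {}" using * a unfolding F_def by (auto simp: not_less intro: order_trans)
    next
      show "F n \<subseteq> F m" if "m \<le> n" for m n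
        using dec' that by (force simp: F_def)
    qed
    then obtain a where a: "a \<in> A" "\<And>n. \<theta> n a \<ge> y" by (auto simp: F_def)
    \<comment> \<open>A negative \<open>g a\<close> would drive \<open>real n * g a\<close> below
      any bound, while \<open>\<psi> n a\<close> never exceeds \<open>\<psi> 0 a\<close>.\<close>
    have "g a = 0"
    proof (rule ccontr)
      assume "g a \<noteq> 0"
      then have neg: "- g a > 0" using g(2)[OF a(1)] by simp
      obtain n where n: "\<psi> 0 a - y < real n * (- g a)" using reals_Archimedean3[OF neg] by blast
      have "\<psi> n a \<le> \<psi> 0 a"
        by (rule lift_Suc_antimono_le[of "\<lambda>n. \<psi> n a"]) (use \<psi>(2) a in auto)
      then show False using n a(2)[of n] by (simp add: \<theta>_def)
    qed
    then have "y \<le> \<psi> n a" for n using a(2)[of n] by (simp add: \<theta>_def)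
    then have "y \<le> \<psi>' a" using LIMSEQ_le_const[OF \<psi>(3)[OF a(1)]] by blast
    also have "\<dots> \<le> (SUP a\<in>?Z. \<psi>' a)" using a \<open>g a = 0\<close> bddZ by (intro cSUP_upper) auto
    finally show False using y by simp
  qed
  have "(\<lambda>n. SUP a\<in>A. \<theta> n a) \<longlonglongrightarrow> (SUP a\<in>?Z. \<psi>' a)"
  proof (rule order_tendstoI)
    fix y assume "y < (SUP a\<in>?Z. \<psi>' a)"
    then show "\<forall>\<^sub>F n in sequentially. y < (SUP a\<in>A. \<theta> n a)"
      using lower by (intro always_eventually allI) (rule less_le_trans)
  next
    fix y assume "(SUP a\<in>?Z. \<psi>' a) < y"
    then obtain n where n: "(SUP a\<in>A. \<theta> n a) < y" using upper by blast
    show "\<forall>\<^sub>F n in sequentially. (SUP a\<in>A. \<theta> n a) < y"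
      unfolding eventually_sequentially
    proof (intro exI allI impI)
      fix m assume "n \<le> m"
      then have "(SUP a\<in>A. \<theta> m a) \<le> (SUP a\<in>A. \<theta> n a)"
        by (intro cSUP_mono ne bdd) (use dec' in auto)
      then show "(SUP a\<in>A. \<theta> m a) < y" using n by simp
    qed
  qed
  then show ?thesis by (simp add: \<theta>_def)
qed

section \<open>Measurable suprema and selections\<close>

lemma borel_measurable_SUP_compact:
  fixes F :: "'x \<Rightarrow> 'a::{second_countable_topology, metric_space} \<Rightarrow> real"
  assumes A: "compact A" "A \<noteq> {}"
    and F: "\<And>a. a \<in> A \<Longrightarrow> (\<lambda>x. F x a) \<in> borel_measurable M"
      "\<And>x. x \<in> space M \<Longrightarrow> continuous_on A (F x)"
  shows "(\<lambda>x. SUP a\<in>A. F x a) \<in> borel_measurable M"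
proof -
  \<comment> \<open>By continuity in the action the supremum over \<open>A\<close> equals the one
    over a countable dense subset, for which measurability is immediate.\<close>
  obtain D where D: "countable D" "D \<subseteq> A" "A \<subseteq> closure D"
    using separable[of A] by blast
  have ne: "D \<noteq> {}" using D(3) A(2) by auto
  have bdd: "bdd_above (F x ` A)" if "x \<in> space M" for x
    using compact_continuous_image[OF F(2)[OF that] A(1)]
    by (intro bounded_imp_bdd_above compact_imp_bounded)
  have eq: "(SUP a\<in>A. F x a) = (SUP a\<in>D. F x a)" if x: "x \<in> space M" for x
  proof (rule antisym)
    show "(SUP a\<in>D. F x a) \<le> (SUP a\<in>A. F x a)"
      by (rule cSUP_subset_mono[OF ne bdd[OF x] D(2)]) simp
    have bddD: "bdd_above (F x ` D)" using bdd[OF x] D(2) by (meson bdd_above_mono image_mono)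
    have "F x ` A \<subseteq> {..SUP a\<in>D. F x a}"
    proof -
      have "closedin (top_of_set A) (A \<inter> F x -` {..SUP a\<in>D. F x a})"
        by (rule continuous_closedin_preimage[OF F(2)[OF x]]) simp
      then have "closed (A \<inter> F x -` {..SUP a\<in>D. F x a})"
        using A(1) closedin_closed_trans compact_imp_closed by blast
      moreover have "D \<subseteq> A \<inter> F x -` {..SUP a\<in>D. F x a}"
        using D(2) bddD by (auto intro: cSUP_upper)
      ultimately have "closure D \<subseteq> A \<inter> F x -` {..SUP a\<in>D. F x a}"
        by (rule closure_minimal[rotated])
      then show ?thesis using D(3) by auto
    qed
    then show "(SUP a\<in>A. F x a) \<le> (SUP a\<in>D. F x a)"
      by (intro cSUP_least A) auto
  qed
  have "(\<lambda>x. SUP a\<in>D. F x a) \<in> borel_measurable M"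
  proof (rule borel_measurable_cSUP[OF D(1)])
    show "(\<lambda>x. F x a) \<in> borel_measurable M" if "a \<in> D" for a using F(1) D that by auto
    show "bdd_above ((\<lambda>i. F x i) ` D)" if "x \<in> space M" for x
      using bdd[OF that] D(2) by (meson bdd_above_mono image_mono)
  qed
  then show ?thesis using eq by (simp cong: measurable_cong)
qed

text \<open>The feasible set moves with \<open>x\<close>, so in general no fixed countable subset
  computes the supremum. The penalised suprema range over all of \<open>A\<close>, hence are
  measurable, and they converge to the constrained one.\<close>

lemma borel_measurable_constrained_SUP:
  fixes g \<psi> :: "'x \<Rightarrow> 'a::{second_countable_topology, metric_space} \<Rightarrow> real"
  assumes A: "compact A"
    and g: "\<And>a. a \<in> A \<Longrightarrow> (\<lambda>x. g x a) \<in> borel_measurable M"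
      "\<And>x. x \<in> space M \<Longrightarrow> continuous_on A (g x)"
      "\<And>x a. x \<in> space M \<Longrightarrow> a \<in> A \<Longrightarrow> g x a \<le> 0"
      "\<And>x. x \<in> space M \<Longrightarrow> \<exists>a\<in>A. g x a = 0"
    and \<psi>: "\<And>a. a \<in> A \<Longrightarrow> (\<lambda>x. \<psi> x a) \<in> borel_measurable M"
      "\<And>x. x \<in> space M \<Longrightarrow> continuous_on A (\<psi> x)"
  shows "(\<lambda>x. SUP a\<in>{a \<in> A. g x a = 0}. \<psi> x a) \<in> borel_measurable M"
proof (cases "space M = {}")
  case True
  then show ?thesis by (simp add: measurable_def)
next
  case False
  then have ne: "A \<noteq> {}" using g(4) by blast
  show ?thesis
  proof (rule borel_measurable_LIMSEQ_real)
    show "(\<lambda>n. SUP a\<in>A. real n * g x a + \<psi> x a) \<longlonglongrightarrow> (SUP a\<in>{a \<in> A. g x a = 0}. \<psi> x a)"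
      if x: "x \<in> space M" for x
      by (rule penalized_sup_tendsto[OF A g(2)[OF x] g(3)[OF x] g(4)[OF x]]) (use \<psi>(2) x in auto)
    show "(\<lambda>x. SUP a\<in>A. real n * g x a + \<psi> x a) \<in> borel_measurable M" for n
      by (rule borel_measurable_SUP_compact[OF A ne]) (intro borel_measurable_add borel_measurable_times
          borel_measurable_const g \<psi> continuous_intros; assumption)+
  qed
qed

text \<open>
  Among the zeros of \<open>h x\<close> the selector successively minimises the distances to the points of a
  dense sequence; these minima are measurable and determine the selected point.
\<close>

lemma measurable_zero_selection:
  fixes h :: "'x \<Rightarrow> 'a::polish_space \<Rightarrow> real"
  assumes A: "compact A"
    and h: "\<And>a. a \<in> A \<Longrightarrow> (\<lambda>x. h x a) \<in> borel_measurable M"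
      "\<And>x. x \<in> space M \<Longrightarrow> continuous_on A (h x)"
      "\<And>x a. x \<in> space M \<Longrightarrow> a \<in> A \<Longrightarrow> 0 \<le> h x a"
      "\<And>x. x \<in> space M \<Longrightarrow> \<exists>a\<in>A. h x a = 0"
  obtains \<phi> where "\<phi> \<in> M \<rightarrow>\<^sub>M borel_on A" "\<And>x. x \<in> space M \<Longrightarrow> h x (\<phi> x) = 0"
proof (cases "space M = {}")
  case True
  then show ?thesis by (intro that[of "\<lambda>_. undefined"]) (auto simp: measurable_def)
next
  case False
  then have ne: "A \<noteq> {}" using h(4) by blast
  obtain D where D: "countable D" "D \<subseteq> A" "A \<subseteq> closure D"
    using separable[of A] by blast
  have neD: "D \<noteq> {}" using D(3) ne by auto
  define d where "d = from_nat_into D"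
  have range_d: "range d = D" unfolding d_def by (rule range_from_nat_into[OF neD D(1)])
  \<comment> \<open>The distance is negated because the measurability lemma speaks of
    suprema.\<close>
  define m where "m f k x = (SUP a\<in>{a \<in> A. f x a = 0}. - dist (d k) a)" for f :: "'x \<Rightarrow> 'a \<Rightarrow> real" and k x
  \<comment> \<open>On \<open>A\<close>, \<open>hh k x\<close> is nonpositive and vanishes exactly
    at the zeros of \<open>h x\<close> that survive the first \<open>k\<close> minimisations.
    Subtracting the deviation from the optimum keeps it in the form that the next measurability step
    requires.\<close>
  define hh where "hh = rec_nat (\<lambda>x a. - h x a) (\<lambda>k f x a. f x a - \<bar>- dist (d k) a - m f k x\<bar>)"
  have hh_0: "hh 0 = (\<lambda>x a. - h x a)"
    and hh_Suc: "hh (Suc k) = (\<lambda>x a. hh k x a - \<bar>- dist (d k) a - m (hh k) k x\<bar>)" for k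
    by (simp_all add: hh_def)
  have inv: "(\<forall>a\<in>A. (\<lambda>x. hh k x a) \<in> borel_measurable M) \<and>
      (\<forall>x\<in>space M. continuous_on A (hh k x) \<and> (\<forall>a\<in>A. hh k x a \<le> 0) \<and> (\<exists>a\<in>A. hh k x a = 0)) \<and>
      m (hh k) k \<in> borel_measurable M" for k
  proof (induction k)
    case 0
    have "m (hh 0) 0 \<in> borel_measurable M"
      unfolding m_def hh_0
      by (rule borel_measurable_constrained_SUP[OF A]) (use h in \<open>auto intro!: continuous_intros\<close>)
    then show ?case using h unfolding hh_0 by (auto intro!: continuous_intros)
  next
    case (Suc k)
    have 1: "(\<lambda>x. hh (Suc k) x a) \<in> borel_measurable M" if "a \<in> A" for a
      using Suc that unfolding hh_Suc by auto
    have 2: "continuous_on A (hh (Suc k) x)" if "x \<in> space M" for x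
      using Suc that unfolding hh_Suc by (auto intro!: continuous_intros)
    have 3: "hh (Suc k) x a \<le> 0" if "x \<in> space M" "a \<in> A" for x a
      using Suc that unfolding hh_Suc by (smt (verit))
    have 4: "\<exists>a\<in>A. hh (Suc k) x a = 0" if x: "x \<in> space M" for x
    proof -
      let ?Z = "{a \<in> A. hh k x a = 0}"
      have "continuous_on A (hh k x)" "\<exists>a\<in>A. hh k x a = 0" using Suc x by blast+
      then have Z: "compact ?Z" "?Z \<noteq> {}" using compact_level_set[OF A, of "hh k x" 0] by auto
      have "continuous_on ?Z (dist (d k))" by (intro continuous_intros)
      from continuous_attains_inf[OF Z this]
      obtain a where a: "a \<in> ?Z" "\<forall>b\<in>?Z. dist (d k) a \<le> dist (d k) b" by (elim bexE)
      have "m (hh k) k x = - dist (d k) a"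
        unfolding m_def by (rule cSup_eq_maximum) (use a in auto)
      then show ?thesis using a(1) unfolding hh_Suc by (intro bexI[of _ a]) auto
    qed
    have "m (hh (Suc k)) (Suc k) \<in> borel_measurable M"
      unfolding m_def by (rule borel_measurable_constrained_SUP[OF A])
        (use 1 2 3 4 in \<open>auto intro!: continuous_intros\<close>)
    then show ?case using 1 2 3 4 by blast
  qed
  have "\<exists>a\<in>A. \<forall>k. hh k x a = 0" if x: "x \<in> space M" for x
  proof -
    define Z where "Z k = {a \<in> A. hh k x a = 0}" for k
    have "\<Inter> (range Z) \<noteq> {}"
    proof (rule compact_decseq_nonempty)
      fix k
      have "continuous_on A (hh k x)" "\<exists>a\<in>A. hh k x a = 0" using inv[of k] x by blast+
      then show "compact (Z k)" "Z k \<noteq> {}"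
        unfolding Z_def using compact_level_set[OF A, of "hh k x" 0] by auto
    next
      \<comment> \<open>A sum of two nonpositive terms vanishes only if both do, so the zero sets
        are nested.\<close>
      have "Z (Suc k) \<subseteq> Z k" for k
        using inv[of k] x by (auto simp: Z_def hh_Suc) (smt (verit))
      then show "Z n \<subseteq> Z k" if "k \<le> n" for k n
        using that by (rule lift_Suc_antimono_le)
    qed
    then show ?thesis by (auto simp: Z_def)
  qed
  \<comment> \<open>No measurable choice is made here: any common zero has the prescribed distances
    to all \<open>d k\<close>, and these are measurable in \<open>x\<close> and identify the
    point.\<close>
  then obtain \<phi> where \<phi>: "\<And>x. x \<in> space M \<Longrightarrow> \<phi> x \<in> A" "\<And>x k. x \<in> space M \<Longrightarrow> hh k x (\<phi> x) = 0"
    by metis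
  have dist_\<phi>: "dist (d k) (\<phi> x) = - m (hh k) k x" if "x \<in> space M" for x k
    using \<phi>(2)[OF that, of k] \<phi>(2)[OF that, of "Suc k"] by (simp add: hh_Suc)
  have meas_dist: "(\<lambda>x. dist (d k) (\<phi> x)) \<in> borel_measurable M" for k
    using inv[of k] dist_\<phi> by (simp cong: measurable_cong)
  have "\<phi> \<in> borel_measurable M"
  proof (rule borel_measurableI)
    fix U :: "'a set" assume U: "open U"
    \<comment> \<open>A point of \<open>A\<close> lies in \<open>U\<close> iff it lies in a rational
      ball around some \<open>d k\<close> that is contained in \<open>U\<close>, so the preimage is
      a countable union of conditions on the distances.\<close>
    define I where "I = {(k, q :: rat). ball (d k) (of_rat q) \<subseteq> U}"
    have "\<phi> -` U \<inter> space M = (\<Union>(k, q)\<in>I. {x \<in> space M. dist (d k) (\<phi> x) < of_rat q})"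
    proof (safe, goal_cases)
      case (1 x)
      obtain e where e: "e > 0" "ball (\<phi> x) e \<subseteq> U" using U 1 by (auto elim: openE)
      obtain y where y: "y \<in> D" "dist y (\<phi> x) < e / 2"
        using D(3) \<phi>(1)[OF 1(1)] e(1) closure_approachable[of "\<phi> x" D] half_gt_zero[OF e(1)] by blast
      obtain k where k: "y = d k" using y range_d by auto
      obtain q where q: "dist y (\<phi> x) < of_rat q" "of_rat q < e / 2" using of_rat_dense[OF y(2)] by blast
      have "ball (d k) (of_rat q) \<subseteq> U"
      proof
        fix z assume z: "z \<in> ball (d k) (of_rat q)"
        have "dist (\<phi> x) z \<le> dist y (\<phi> x) + dist y z" by (metis dist_commute dist_triangle)
        also have "\<dots> < e" using z q k by simp
        finally show "z \<in> U" using e(2) by auto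
      qed
      then show ?case using 1 q k by (auto simp: I_def intro!: bexI[of _ "(k, q)"])
    next
      case (2 x k q)
      then show ?case by (auto simp: I_def)
    qed
    also have "\<dots> \<in> sets M"
      using meas_dist by (intro sets.countable_UN') (auto intro!: countableI_type)
    finally show "\<phi> -` U \<inter> space M \<in> sets M" .
  qed
  moreover have "\<phi> \<in> space M \<rightarrow> A" using \<phi>(1) by auto
  ultimately have "\<phi> \<in> M \<rightarrow>\<^sub>M borel_on A" by (rule measurable_restrict_space2[rotated])
  moreover have "h x (\<phi> x) = 0" if "x \<in> space M" for x
    using \<phi>(2)[OF that, of 0] by (simp add: hh_0)
  ultimately show ?thesis by (rule that)
qed

text \<open>Setwise continuity is continuity for indicators, hence for functions with finitely many
  values. Rounding \<open>v\<close> down to a multiple of \<open>1 / real (Suc n)\<close>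
  approximates it uniformly by such functions, with an error that does not depend on the measure, so
  continuity survives the limit.\<close>

lemma continuous_on_integral_setwise:
  fixes v :: "'x \<Rightarrow> real"
  assumes \<mu>: "\<And>a. a \<in> A \<Longrightarrow> \<mu> a \<in> space (prob_algebra M)"
    and cont: "\<And>B. B \<in> sets M \<Longrightarrow> continuous_on A (\<lambda>a. measure (\<mu> a) B)"
    and v: "v \<in> borel_measurable M" "\<And>x. x \<in> space M \<Longrightarrow> \<bar>v x\<bar> \<le> C"
  shows "continuous_on A (\<lambda>a. \<integral>x. v x \<partial>\<mu> a)"
proof -
  define vn where "vn n x = real_of_int \<lfloor>real (Suc n) * v x\<rfloor> / real (Suc n)" for n x
  define B where "B n j = {x \<in> space M. \<lfloor>real (Suc n) * v x\<rfloor> = j}" for n and j :: int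
  define J where "J n = {\<lfloor>- real (Suc n) * C\<rfloor>..\<lfloor>real (Suc n) * C\<rfloor>}" for n
  have B: "B n j \<in> sets M" for n j unfolding B_def using v(1) by measurable
  have P: "prob_space (\<mu> a)" "sets (\<mu> a) = sets M" "space (\<mu> a) = space M" if "a \<in> A" for a
    using \<mu>[OF that] sets_eq_imp_space_eq[of "\<mu> a" M] by (auto simp: space_prob_algebra)
  have vn_eq: "vn n x = (\<Sum>j\<in>J n. real_of_int j / real (Suc n) * indicator (B n j) x)"
    if x: "x \<in> space M" for n x
  proof -
    have "- C \<le> v x" "v x \<le> C" using v(2)[OF x] by auto
    then have "real (Suc n) * (- C) \<le> real (Suc n) * v x" "real (Suc n) * v x \<le> real (Suc n) * C"
      by (intro mult_left_mono; simp)+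
    then have "\<lfloor>real (Suc n) * v x\<rfloor> \<in> J n"
      unfolding J_def atLeastAtMost_iff mult_minus_right mult_minus_left by (intro conjI floor_mono)
    then have "(\<Sum>j\<in>J n. real_of_int j / real (Suc n) * indicator (B n j) x) =
        (\<Sum>j\<in>J n. if j = \<lfloor>real (Suc n) * v x\<rfloor> then real_of_int j / real (Suc n) else 0)"
      using x by (intro sum.cong) (auto simp: B_def indicator_def)
    then show ?thesis using \<open>_ \<in> J n\<close> by (simp add: vn_def J_def)
  qed
  have int_v: "integrable (\<mu> a) v" if a: "a \<in> A" for a
  proof -
    interpret prob_space "\<mu> a" by (rule P[OF a])
    show ?thesis
      by (rule integrable_const_bound[of _ C]) (use v P[OF a] in \<open>auto cong: measurable_cong_sets\<close>)
  qed
  have int_B: "integrable (\<mu> a) (\<lambda>x. c * indicator (B n j) x :: real)" if a: "a \<in> A" for a n j c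
  proof -
    interpret prob_space "\<mu> a" by (rule P[OF a])
    show ?thesis using B P[OF a] by (intro integrable_mult_right) (simp add: less_top[symmetric])
  qed
  have vn_int: "(\<integral>x. vn n x \<partial>\<mu> a) = (\<Sum>j\<in>J n. real_of_int j / real (Suc n) * measure (\<mu> a) (B n j))"
    and int_vn: "integrable (\<mu> a) (vn n)" if a: "a \<in> A" for n a
  proof -
    have eq: "(\<integral>x. vn n x \<partial>\<mu> a) = (\<integral>x. (\<Sum>j\<in>J n. real_of_int j / real (Suc n) * indicator (B n j) x) \<partial>\<mu> a)"
      using vn_eq P[OF a] by (intro Bochner_Integration.integral_cong) auto
    also have "\<dots> = (\<Sum>j\<in>J n. real_of_int j / real (Suc n) * measure (\<mu> a) (B n j))"
      using B P[OF a] sets.sets_into_space[OF B]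
      by (subst Bochner_Integration.integral_sum[OF int_B[OF a]]) (simp add: Int_absorb2)
    finally show "(\<integral>x. vn n x \<partial>\<mu> a) = (\<Sum>j\<in>J n. real_of_int j / real (Suc n) * measure (\<mu> a) (B n j))" .
    have "integrable (\<mu> a) (\<lambda>x. \<Sum>j\<in>J n. real_of_int j / real (Suc n) * indicator (B n j) x)"
      by (intro Bochner_Integration.integrable_sum int_B[OF a])
    then show "integrable (\<mu> a) (vn n)"
      by (rule Bochner_Integration.integrable_cong[THEN iffD2, rotated 2]) (simp_all add: vn_eq P[OF a])
  qed
  have close: "\<bar>vn n x - v x\<bar> \<le> 1 / real (Suc n)" for n x
  proof -
    have "\<bar>real_of_int \<lfloor>real (Suc n) * v x\<rfloor> - real (Suc n) * v x\<bar> \<le> 1" by linarith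
    then have "\<bar>real_of_int \<lfloor>real (Suc n) * v x\<rfloor> - real (Suc n) * v x\<bar> / real (Suc n) \<le> 1 / real (Suc n)"
      by (rule divide_right_mono) simp
    moreover have "vn n x - v x = (real_of_int \<lfloor>real (Suc n) * v x\<rfloor> - real (Suc n) * v x) / real (Suc n)"
      by (simp add: vn_def diff_divide_distrib del: of_nat_Suc)
    ultimately show ?thesis by (simp add: abs_divide)
  qed
  have "uniform_limit A (\<lambda>n a. \<integral>x. vn n x \<partial>\<mu> a) (\<lambda>a. \<integral>x. v x \<partial>\<mu> a) sequentially"
    unfolding uniform_limit_sequentially_iff
  proof (intro allI impI)
    fix e :: real assume "e > 0"
    then obtain N where N: "1 / real (Suc N) < e" using nat_approx_posE by metis
    show "\<exists>N. \<forall>n\<ge>N. \<forall>a\<in>A. dist (\<integral>x. vn n x \<partial>\<mu> a) (\<integral>x. v x \<partial>\<mu> a) < e"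
    proof (intro exI allI impI ballI)
      fix n a assume n: "n \<ge> N" and a: "a \<in> A"
      interpret prob_space "\<mu> a" by (rule P[OF a])
      have "\<bar>\<integral>x. vn n x - v x \<partial>\<mu> a\<bar> \<le> (\<integral>x. \<bar>vn n x - v x\<bar> \<partial>\<mu> a)" by (rule integral_abs_bound)
      also have "\<dots> \<le> (\<integral>x. 1 / real (Suc n) \<partial>\<mu> a)"
        by (rule integral_mono) (use close int_vn[OF a] int_v[OF a] in auto)
      also have "\<dots> = 1 / real (Suc n)" by (simp add: prob_space)
      also have "\<dots> \<le> 1 / real (Suc N)" using n by (simp add: frac_le)
      also note N
      finally show "dist (\<integral>x. vn n x \<partial>\<mu> a) (\<integral>x. v x \<partial>\<mu> a) < e"
        using int_vn[OF a] int_v[OF a] by (simp add: dist_real_def)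
    qed
  qed
  moreover have "continuous_on A (\<lambda>a. \<integral>x. vn n x \<partial>\<mu> a)" for n
  proof -
    have "continuous_on A (\<lambda>a. \<Sum>j\<in>J n. real_of_int j / real (Suc n) * measure (\<mu> a) (B n j))"
      by (intro continuous_intros cont B)
    then show ?thesis using vn_int by (simp cong: continuous_on_cong)
  qed
  ultimately show ?thesis
    by (intro uniform_limit_theorem[where F = sequentially and f = "\<lambda>n a. \<integral>x. vn n x \<partial>\<mu> a"]) auto
qed

section \<open>Bounded measurable functions and kernels\<close>

text \<open>The class on which all later integrals are finite; it is closed under integration
  against a probability kernel, so value functions never leave it.\<close>

definition bdd_measurable :: "'x measure \<Rightarrow> ('x \<Rightarrow> real) set" where
  "bdd_measurable M = {f \<in> borel_measurable M. \<exists>C. \<forall>x\<in>space M. \<bar>f x\<bar> \<le> C}"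

lemma bdd_measurableI:
  "f \<in> borel_measurable M \<Longrightarrow> (\<And>x. x \<in> space M \<Longrightarrow> \<bar>f x\<bar> \<le> C) \<Longrightarrow> f \<in> bdd_measurable M"
  by (auto simp: bdd_measurable_def)

lemma bdd_measurableD: "f \<in> bdd_measurable M \<Longrightarrow> f \<in> borel_measurable M"
  by (auto simp: bdd_measurable_def)

lemma bdd_measurable_bound:
  assumes "f \<in> bdd_measurable M"
  obtains C where "0 \<le> C" "\<And>x. x \<in> space M \<Longrightarrow> \<bar>f x\<bar> \<le> C"
proof -
  from assms obtain C where "\<forall>x\<in>space M. \<bar>f x\<bar> \<le> C" by (auto simp: bdd_measurable_def)
  \<comment> \<open>On an empty space the given bound may be negative, hence the maximum with
    0.\<close>
  then show ?thesis by (intro that[of "max 0 C"]) (auto simp: le_max_iff_disj)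
qed

lemma bdd_measurable_unit: "f \<in> M \<rightarrow>\<^sub>M borel_on {0..1 :: real} \<Longrightarrow> f \<in> bdd_measurable M"
  by (intro bdd_measurableI[of _ _ 1]) (auto simp: measurable_restrict_space2_iff Pi_iff)

lemma bdd_measurable_const: "(\<lambda>_. c) \<in> bdd_measurable M"
  by (rule bdd_measurableI[of _ _ "\<bar>c\<bar>"]) auto

lemma bdd_measurable_add:
  assumes "f \<in> bdd_measurable M" "g \<in> bdd_measurable M"
  shows "(\<lambda>x. f x + g x) \<in> bdd_measurable M"
proof -
  obtain C D where C: "\<And>x. x \<in> space M \<Longrightarrow> \<bar>f x\<bar> \<le> C" and D: "\<And>x. x \<in> space M \<Longrightarrow> \<bar>g x\<bar> \<le> D"
    using assms by (auto elim!: bdd_measurable_bound)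
  show ?thesis
  proof (rule bdd_measurableI)
    show "\<bar>f x + g x\<bar> \<le> C + D" if "x \<in> space M" for x
      using C[OF that] D[OF that] by linarith
  qed (use assms[THEN bdd_measurableD] in simp)
qed

lemma bdd_measurable_cmult:
  assumes "f \<in> bdd_measurable M"
  shows "(\<lambda>x. c * f x) \<in> bdd_measurable M"
proof -
  obtain C where C: "0 \<le> C" "\<And>x. x \<in> space M \<Longrightarrow> \<bar>f x\<bar> \<le> C"
    using bdd_measurable_bound[OF assms] by blast
  show ?thesis
  proof (rule bdd_measurableI)
    show "\<bar>c * f x\<bar> \<le> \<bar>c\<bar> * C" if "x \<in> space M" for x
      using C(2)[OF that] by (simp add: abs_mult mult_left_mono)
  qed (use assms[THEN bdd_measurableD] in simp)
qed

lemma bdd_measurable_uminus: "f \<in> bdd_measurable M \<Longrightarrow> (\<lambda>x. - f x) \<in> bdd_measurable M"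
  using bdd_measurable_cmult[of f M "-1"] by simp

lemma bdd_measurable_sum:
  "(\<And>i. i \<in> I \<Longrightarrow> f i \<in> bdd_measurable M) \<Longrightarrow> (\<lambda>x. \<Sum>i\<in>I. f i x) \<in> bdd_measurable M"
  by (induction I rule: infinite_finite_induct)
    (auto intro: bdd_measurable_const bdd_measurable_add)

lemma bdd_measurable_compose:
  assumes "f \<in> bdd_measurable N" "g \<in> M \<rightarrow>\<^sub>M N"
  shows "(\<lambda>x. f (g x)) \<in> bdd_measurable M"
proof -
  obtain C where "\<And>x. x \<in> space N \<Longrightarrow> \<bar>f x\<bar> \<le> C"
    using assms by (auto elim!: bdd_measurable_bound)
  then show ?thesis
    using assms(1)[THEN bdd_measurableD] assms(2) measurable_space[OF assms(2)]
    by (intro bdd_measurableI[of _ _ C]) auto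
qed

lemma prob_algebra_space_eq: "\<mu> \<in> space (prob_algebra M) \<Longrightarrow> space \<mu> = space M"
  using sets_eq_imp_space_eq[of \<mu> M] by (simp add: space_prob_algebra)

lemma prob_algebra_measurable_eq: "\<mu> \<in> space (prob_algebra M) \<Longrightarrow> \<mu> \<rightarrow>\<^sub>M N = M \<rightarrow>\<^sub>M N"
  by (rule measurable_cong_sets) (auto simp: space_prob_algebra)

lemma bdd_measurable_integrable:
  assumes "\<mu> \<in> space (prob_algebra M)" "f \<in> bdd_measurable M"
  shows "integrable \<mu> f"
proof -
  interpret prob_space \<mu> using assms(1) by (simp add: space_prob_algebra)
  obtain C where C: "\<And>x. x \<in> space M \<Longrightarrow> \<bar>f x\<bar> \<le> C"
    using assms(2) by (auto elim!: bdd_measurable_bound)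
  show ?thesis
    by (rule integrable_const_bound[of _ C])
      (use C assms(2) in \<open>auto simp: prob_algebra_space_eq[OF assms(1)]
        prob_algebra_measurable_eq[OF assms(1)] bdd_measurableD\<close>)
qed

lemma prob_algebra_integral_const:
  "\<mu> \<in> space (prob_algebra M) \<Longrightarrow> (\<integral>x. c \<partial>\<mu>) = (c::real)"
  by (simp add: space_prob_algebra prob_space.prob_space)

lemma prob_algebra_integral_mono:
  assumes "\<mu> \<in> space (prob_algebra M)" "f \<in> bdd_measurable M" "g \<in> bdd_measurable M"
    "\<And>x. x \<in> space M \<Longrightarrow> f x \<le> g x"
  shows "(\<integral>x. f x \<partial>\<mu>) \<le> (\<integral>x. g x \<partial>\<mu>)"
  using assms by (intro integral_mono bdd_measurable_integrable) (auto simp: prob_algebra_space_eq)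

lemma prob_algebra_integral_abs_le:
  assumes "\<mu> \<in> space (prob_algebra M)" "f \<in> bdd_measurable M" "\<And>x. x \<in> space M \<Longrightarrow> \<bar>f x\<bar> \<le> C"
  shows "\<bar>\<integral>x. f x \<partial>\<mu>\<bar> \<le> C"
proof -
  have "(\<integral>x. f x \<partial>\<mu>) \<le> (\<integral>x. C \<partial>\<mu>)" "(\<integral>x. - C \<partial>\<mu>) \<le> (\<integral>x. f x \<partial>\<mu>)"
    by (rule prob_algebra_integral_mono[OF assms(1)];
        use assms in \<open>auto intro: bdd_measurable_const simp: abs_le_iff\<close>; fastforce)+
  then show ?thesis unfolding prob_algebra_integral_const[OF assms(1)] by (simp add: abs_le_iff)
qed

text \<open>The integrand depends on the parameter too. Pushing \<open>\<kappa> x\<close> forward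
  along \<open>Pair x\<close> moves this dependence into the measure, and a fixed function is then
  integrated against a measurable kernel.\<close>

lemma bdd_measurable_kernel_integral:
  assumes f: "(\<lambda>(x, y). f x y) \<in> bdd_measurable (M \<Otimes>\<^sub>M N)" and \<kappa>: "\<kappa> \<in> M \<rightarrow>\<^sub>M prob_algebra N"
  shows "(\<lambda>x. \<integral>y. f x y \<partial>\<kappa> x) \<in> bdd_measurable M"
proof -
  obtain C where C: "\<And>z. z \<in> space (M \<Otimes>\<^sub>M N) \<Longrightarrow> \<bar>case z of (x, y) \<Rightarrow> f x y\<bar> \<le> C"
    using bdd_measurable_bound[OF f] by metis
  note [measurable] = f[THEN bdd_measurableD]
  show ?thesis
  proof (rule bdd_measurableI)
    have "(\<lambda>x. distr (\<kappa> x) (M \<Otimes>\<^sub>M N) (Pair x)) \<in> M \<rightarrow>\<^sub>M subprob_algebra (M \<Otimes>\<^sub>M N)"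
      by (rule measurable_distr2[OF _ measurable_prob_algebraD[OF \<kappa>]]) simp
    then have "(\<lambda>x. \<integral>z. (case z of (x, y) \<Rightarrow> f x y) \<partial>distr (\<kappa> x) (M \<Otimes>\<^sub>M N) (Pair x)) \<in> borel_measurable M"
      by (rule measurable_compose) (rule integral_measurable_subprob_algebra, measurable)
    moreover have "(\<integral>z. (case z of (x, y) \<Rightarrow> f x y) \<partial>distr (\<kappa> x) (M \<Otimes>\<^sub>M N) (Pair x)) = (\<integral>y. f x y \<partial>\<kappa> x)"
      if x: "x \<in> space M" for x
      using x measurable_space[OF \<kappa> x]
      by (subst integral_distr) (auto simp: prob_algebra_measurable_eq)
    ultimately show "(\<lambda>x. \<integral>y. f x y \<partial>\<kappa> x) \<in> borel_measurable M"
      by (simp cong: measurable_cong)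
  next
    fix x assume x: "x \<in> space M"
    have "Pair x \<in> N \<rightarrow>\<^sub>M M \<Otimes>\<^sub>M N" using x by simp
    from bdd_measurable_compose[OF f this] have "f x \<in> bdd_measurable N" by simp
    then show "\<bar>\<integral>y. f x y \<partial>\<kappa> x\<bar> \<le> C"
      using C x measurable_space[OF \<kappa> x]
      by (intro prob_algebra_integral_abs_le) (auto simp: space_pair_measure)
  qed
qed

lemma bdd_measurable_integral_kernel:
  assumes "v \<in> bdd_measurable N" "\<kappa> \<in> M \<rightarrow>\<^sub>M prob_algebra N"
  shows "(\<lambda>x. \<integral>y. v y \<partial>\<kappa> x) \<in> bdd_measurable M"
  using bdd_measurable_compose[OF assms(1) measurable_snd, of M]
  by (intro bdd_measurable_kernel_integral[OF _ assms(2)]) (simp add: case_prod_beta')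

lemma integral_bind_bdd:
  assumes \<mu>: "\<mu> \<in> space (prob_algebra M)" and \<kappa>: "\<kappa> \<in> M \<rightarrow>\<^sub>M prob_algebra N"
    and f: "f \<in> bdd_measurable N"
  shows "(\<integral>x. f x \<partial>bind \<mu> \<kappa>) = (\<integral>x. (\<integral>y. f y \<partial>\<kappa> x) \<partial>\<mu>)"
proof -
  obtain C where C: "\<And>x. x \<in> space N \<Longrightarrow> \<bar>f x\<bar> \<le> C"
    using f by (auto elim!: bdd_measurable_bound)
  interpret prob_space \<mu> using \<mu> by (simp add: space_prob_algebra)
  show ?thesis
  proof (rule integral_bind[OF bdd_measurableD[OF f] C])
    show "\<kappa> \<in> \<mu> \<rightarrow>\<^sub>M subprob_algebra N"
      using measurable_prob_algebraD[OF \<kappa>] \<mu> by (simp add: prob_algebra_measurable_eq)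
    have "emeasure (\<kappa> x) (space (\<kappa> x)) \<le> ennreal 1" if "x \<in> space \<mu>" for x
    proof -
      have "prob_space (\<kappa> x)"
        using measurable_space[OF \<kappa>] that prob_algebra_space_eq[OF \<mu>] by (auto simp: space_prob_algebra)
      then show ?thesis by (simp add: prob_space.emeasure_space_1)
    qed
    then show "AE x in \<mu>. emeasure (\<kappa> x) (space (\<kappa> x)) \<le> ennreal 1" by (rule AE_I2)
  qed unfold_locales
qed

section \<open>History laws\<close>

text \<open>This function and \<open>step_kernel\<close> name the inner terms of
  \<open>history_law\<close>, so that their measurability in all arguments can be stated.\<close>

definition extend_history :: "nat \<Rightarrow> ('s, 'a) history \<Rightarrow> 'a \<Rightarrow> 's \<Rightarrow> ('s, 'a) history" where
  "extend_history t h a s = ((fst h)(t := (snd h, a)), s)"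

definition step_kernel ::
    "'s measure \<Rightarrow> 'a measure \<Rightarrow> ('s \<times> 'a \<Rightarrow> 's measure) \<Rightarrow> nat \<Rightarrow> ('s, 'a) history \<Rightarrow> 'a
      \<Rightarrow> ('s, 'a) history measure" where
  "step_kernel M N P t h a = distr (P (snd h, a)) (history_space M N (Suc t)) (extend_history t h a)"

lemma history_law_Suc:
  "history_law M N P s\<^sub>0 \<pi> (Suc t) =
     bind (history_law M N P s\<^sub>0 \<pi> t) (\<lambda>h. bind (\<pi> t h) (step_kernel M N P t h))"
  unfolding history_law.simps step_kernel_def[abs_def] extend_history_def[abs_def] ..

lemma measurable_extend_history:
  "(\<lambda>((h, a), s). extend_history t h a s) \<in>
     (history_space M N t \<Otimes>\<^sub>M N) \<Otimes>\<^sub>M M \<rightarrow>\<^sub>M history_space M N (Suc t)"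
proof -
  let ?S = "(((\<Pi>\<^sub>M i\<in>{..<t}. M \<Otimes>\<^sub>M N) \<Otimes>\<^sub>M M) \<Otimes>\<^sub>M N) \<Otimes>\<^sub>M M"
  have "(\<lambda>(w, z). w(t := z)) \<in>
      (\<Pi>\<^sub>M i\<in>{..<t}. M \<Otimes>\<^sub>M N) \<Otimes>\<^sub>M (M \<Otimes>\<^sub>M N) \<rightarrow>\<^sub>M (\<Pi>\<^sub>M i\<in>{..<Suc t}. M \<Otimes>\<^sub>M N)"
    unfolding lessThan_Suc by (rule measurable_add_dim)
  moreover have "(\<lambda>z. (fst (fst (fst z)), (snd (fst (fst z)), snd (fst z)))) \<in>
      ?S \<rightarrow>\<^sub>M (\<Pi>\<^sub>M i\<in>{..<t}. M \<Otimes>\<^sub>M N) \<Otimes>\<^sub>M (M \<Otimes>\<^sub>M N)"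
    by measurable
  ultimately have "(\<lambda>z. (fst (fst (fst z)))(t := (snd (fst (fst z)), snd (fst z)))) \<in>
      ?S \<rightarrow>\<^sub>M (\<Pi>\<^sub>M i\<in>{..<Suc t}. M \<Otimes>\<^sub>M N)"
    using measurable_compose by fastforce
  then show ?thesis
    unfolding history_space_def extend_history_def case_prod_beta'
    by (intro measurable_Pair measurable_snd) simp_all
qed

lemma measurable_step_kernel:
  assumes "P \<in> M \<Otimes>\<^sub>M N \<rightarrow>\<^sub>M prob_algebra M"
  shows "(\<lambda>(h, a). step_kernel M N P t h a) \<in>
     history_space M N t \<Otimes>\<^sub>M N \<rightarrow>\<^sub>M prob_algebra (history_space M N (Suc t))"
proof -
  have "(\<lambda>(h, a). (snd h, a)) \<in> history_space M N t \<Otimes>\<^sub>M N \<rightarrow>\<^sub>M M \<Otimes>\<^sub>M N"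
    unfolding history_space_def by measurable
  from measurable_compose[OF this assms]
  have "(\<lambda>z. P (snd (fst z), snd z)) \<in> history_space M N t \<Otimes>\<^sub>M N \<rightarrow>\<^sub>M prob_algebra M"
    by (simp add: case_prod_beta)
  from measurable_distr_prob_space2[OF this, of "\<lambda>z. extend_history t (fst z) (snd z)"]
    measurable_extend_history
  show ?thesis unfolding step_kernel_def case_prod_beta' by blast
qed

lemma policy_in_prob_algebra:
  assumes "\<pi> \<in> policies M N H" "t < H" "h \<in> space (history_space M N t)"
  shows "\<pi> t h \<in> space (prob_algebra N)"
  using assms by (intro measurable_space[OF _ assms(3)]) (auto simp: policies_def)

lemma measurable_policy_step:
  assumes "P \<in> M \<Otimes>\<^sub>M N \<rightarrow>\<^sub>M prob_algebra M" "\<pi> \<in> policies M N H" "t < H"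
  shows "(\<lambda>h. bind (\<pi> t h) (step_kernel M N P t h)) \<in>
    history_space M N t \<rightarrow>\<^sub>M prob_algebra (history_space M N (Suc t))"
  using measurable_step_kernel[OF assms(1)] assms(2,3)
  by (intro measurable_bind_prob_space2) (auto simp: policies_def)

lemma history_law_in_prob_algebra:
  assumes "P \<in> M \<Otimes>\<^sub>M N \<rightarrow>\<^sub>M prob_algebra M" "s\<^sub>0 \<in> space M" "\<pi> \<in> policies M N H" "t \<le> H"
  shows "history_law M N P s\<^sub>0 \<pi> t \<in> space (prob_algebra (history_space M N t))"
  using assms(4)
proof (induction t)
  case 0
  have "(\<lambda>_. undefined, s\<^sub>0) \<in> space (history_space M N 0)"
    using assms(2) by (simp add: history_space_def space_pair_measure space_PiM)
  then show ?case by (simp add: space_prob_algebra prob_space_return)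
next
  case (Suc t)
  then show ?case
    unfolding history_law_Suc
    using measurable_policy_step[OF assms(1,3), of t]
      measurable_space[OF measurable_bind_prob_space[OF measurable_ident]]
    by (metis (no_types, lifting) Suc_le_eq less_imp_le id_apply)
qed

lemma integral_history_law_Suc:
  assumes P: "P \<in> M \<Otimes>\<^sub>M N \<rightarrow>\<^sub>M prob_algebra M" and s\<^sub>0: "s\<^sub>0 \<in> space M"
    and \<pi>: "\<pi> \<in> policies M N H" and t: "t < H"
    and f: "f \<in> bdd_measurable (history_space M N (Suc t))"
  shows "(\<integral>h. f h \<partial>history_law M N P s\<^sub>0 \<pi> (Suc t)) =
    (\<integral>h. (\<integral>a. (\<integral>s. f (extend_history t h a s) \<partial>P (snd h, a)) \<partial>\<pi> t h) \<partial>history_law M N P s\<^sub>0 \<pi> t)"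
proof -
  let ?L = "history_law M N P s\<^sub>0 \<pi> t"
  have L: "?L \<in> space (prob_algebra (history_space M N t))"
    using history_law_in_prob_algebra[OF P s\<^sub>0 \<pi>] t by simp
  have "(\<integral>h. f h \<partial>history_law M N P s\<^sub>0 \<pi> (Suc t)) =
      (\<integral>h. (\<integral>x. f x \<partial>bind (\<pi> t h) (step_kernel M N P t h)) \<partial>?L)"
    unfolding history_law_Suc by (rule integral_bind_bdd[OF L measurable_policy_step[OF P \<pi> t] f])
  also have "\<dots> = (\<integral>h. (\<integral>a. (\<integral>s. f (extend_history t h a s) \<partial>P (snd h, a)) \<partial>\<pi> t h) \<partial>?L)"
  proof (rule Bochner_Integration.integral_cong[OF refl])
    fix h assume "h \<in> space ?L"
    then have h: "h \<in> space (history_space M N t)" by (simp add: prob_algebra_space_eq[OF L])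
    then have snd_h: "snd h \<in> space M" by (auto simp: history_space_def space_pair_measure)
    have \<pi>h: "\<pi> t h \<in> space (prob_algebra N)"
      by (rule policy_in_prob_algebra[OF \<pi> t h])
    have "step_kernel M N P t h \<in> N \<rightarrow>\<^sub>M prob_algebra (history_space M N (Suc t))"
      using measurable_compose[OF measurable_Pair1'[OF h] measurable_step_kernel[OF P]] by simp
    then have "(\<integral>x. f x \<partial>bind (\<pi> t h) (step_kernel M N P t h)) =
        (\<integral>a. (\<integral>x. f x \<partial>step_kernel M N P t h a) \<partial>\<pi> t h)"
      by (rule integral_bind_bdd[OF \<pi>h _ f])
    also have "\<dots> = (\<integral>a. (\<integral>s. f (extend_history t h a s) \<partial>P (snd h, a)) \<partial>\<pi> t h)"
    proof (rule Bochner_Integration.integral_cong[OF refl])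
      fix a assume "a \<in> space (\<pi> t h)"
      then have a: "a \<in> space N" by (simp add: prob_algebra_space_eq[OF \<pi>h])
      have "P (snd h, a) \<in> space (prob_algebra M)"
        using measurable_space[OF P] a snd_h by (auto simp: space_pair_measure)
      moreover have "extend_history t h a \<in> M \<rightarrow>\<^sub>M history_space M N (Suc t)"
        using measurable_compose[OF measurable_Pair1' measurable_extend_history, of "(h, a)"] h a
        by (simp add: space_pair_measure)
      ultimately show "(\<integral>x. f x \<partial>step_kernel M N P t h a) = (\<integral>s. f (extend_history t h a s) \<partial>P (snd h, a))"
        unfolding step_kernel_def
        by (intro integral_distr) (auto simp: prob_algebra_measurable_eq bdd_measurableD[OF f])
    qed
    finally show "(\<integral>x. f x \<partial>bind (\<pi> t h) (step_kernel M N P t h)) =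
      (\<integral>a. (\<integral>s. f (extend_history t h a s) \<partial>P (snd h, a)) \<partial>\<pi> t h)" .
  qed
  finally show ?thesis .
qed

lemma bdd_measurable_history_value:
  assumes r: "\<And>i. r i \<in> bdd_measurable (M \<Otimes>\<^sub>M N)" and v: "v \<in> bdd_measurable M"
  shows "(\<lambda>h. (\<Sum>i<t. r i (fst h i)) + v (snd h)) \<in> bdd_measurable (history_space M N t)"
proof (intro bdd_measurable_add bdd_measurable_sum)
  show "(\<lambda>h. v (snd h)) \<in> bdd_measurable (history_space M N t)"
    unfolding history_space_def by (rule bdd_measurable_compose[OF v]) measurable
  fix i assume "i \<in> {..<t}"
  then show "(\<lambda>h. r i (fst h i)) \<in> bdd_measurable (history_space M N t)"
    unfolding history_space_def by (intro bdd_measurable_compose[OF r]) measurable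
qed

text \<open>The first \<open>t\<close> rewards are constant for the two inner integrals, so one step
  of the process replaces the terminal function \<open>v\<close> by its one-stage expected return.
  Iterating this is backward induction.\<close>

lemma history_value_Suc:
  assumes P: "P \<in> M \<Otimes>\<^sub>M N \<rightarrow>\<^sub>M prob_algebra M" and s\<^sub>0: "s\<^sub>0 \<in> space M"
    and \<pi>: "\<pi> \<in> policies M N H" and t: "t < H"
    and r: "\<And>i. r i \<in> bdd_measurable (M \<Otimes>\<^sub>M N)" and v: "v \<in> bdd_measurable M"
  shows "(\<integral>h. (\<Sum>i<Suc t. r i (fst h i)) + v (snd h) \<partial>history_law M N P s\<^sub>0 \<pi> (Suc t)) =
    (\<integral>h. (\<Sum>i<t. r i (fst h i)) + (\<integral>a. r t (snd h, a) + (\<integral>s. v s \<partial>P (snd h, a)) \<partial>\<pi> t h)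
      \<partial>history_law M N P s\<^sub>0 \<pi> t)"
proof (subst integral_history_law_Suc[OF P s\<^sub>0 \<pi> t bdd_measurable_history_value[OF r v]],
    rule Bochner_Integration.integral_cong[OF refl])
  let ?L = "history_law M N P s\<^sub>0 \<pi> t"
  have L: "?L \<in> space (prob_algebra (history_space M N t))"
    using history_law_in_prob_algebra[OF P s\<^sub>0 \<pi>] t by simp
  fix h assume "h \<in> space ?L"
  then have h: "h \<in> space (history_space M N t)" by (simp add: prob_algebra_space_eq[OF L])
  then have snd_h: "snd h \<in> space M" by (auto simp: history_space_def space_pair_measure)
  have \<pi>h: "\<pi> t h \<in> space (prob_algebra N)"
    by (rule policy_in_prob_algebra[OF \<pi> t h])
  let ?R = "\<Sum>i<t. r i (fst h i)"
  have "(\<integral>s. (\<Sum>i<Suc t. r i (fst (extend_history t h a s) i)) + v (snd (extend_history t h a s)) \<partial>P (snd h, a)) =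
      ?R + (r t (snd h, a) + (\<integral>s. v s \<partial>P (snd h, a)))" if a: "a \<in> space N" for a
  proof -
    have Pa: "P (snd h, a) \<in> space (prob_algebra M)"
      using measurable_space[OF P] a snd_h by (auto simp: space_pair_measure)
    have "(\<integral>s. (\<Sum>i<Suc t. r i (fst (extend_history t h a s) i)) + v (snd (extend_history t h a s)) \<partial>P (snd h, a)) =
        (\<integral>s. (?R + r t (snd h, a)) + v s \<partial>P (snd h, a))"
      by (simp add: extend_history_def)
    also have "\<dots> = (\<integral>s. ?R + r t (snd h, a) \<partial>P (snd h, a)) + (\<integral>s. v s \<partial>P (snd h, a))"
      by (intro Bochner_Integration.integral_add bdd_measurable_integrable[OF Pa] bdd_measurable_const v)
    finally show ?thesis using prob_algebra_integral_const[OF Pa] by simp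
  qed
  then have "(\<integral>a. (\<integral>s. (\<Sum>i<Suc t. r i (fst (extend_history t h a s) i)) + v (snd (extend_history t h a s)) \<partial>P (snd h, a)) \<partial>\<pi> t h) =
      (\<integral>a. ?R + (r t (snd h, a) + (\<integral>s. v s \<partial>P (snd h, a))) \<partial>\<pi> t h)"
    by (intro Bochner_Integration.integral_cong) (auto simp: prob_algebra_space_eq[OF \<pi>h])
  also have "\<dots> = (\<integral>a. ?R \<partial>\<pi> t h) + (\<integral>a. r t (snd h, a) + (\<integral>s. v s \<partial>P (snd h, a)) \<partial>\<pi> t h)"
  proof (intro Bochner_Integration.integral_add bdd_measurable_integrable[OF \<pi>h] bdd_measurable_const)
    have "(\<lambda>z. r t z + (\<integral>s. v s \<partial>P z)) \<in> bdd_measurable (M \<Otimes>\<^sub>M N)"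
      by (intro bdd_measurable_add r bdd_measurable_integral_kernel[OF v P])
    then show "(\<lambda>a. r t (snd h, a) + (\<integral>s. v s \<partial>P (snd h, a))) \<in> bdd_measurable N"
      by (rule bdd_measurable_compose) (use snd_h in simp)
  qed
  finally show "(\<integral>a. (\<integral>s. (\<Sum>i<Suc t. r i (fst (extend_history t h a s) i)) + v (snd (extend_history t h a s)) \<partial>P (snd h, a)) \<partial>\<pi> t h) =
      ?R + (\<integral>a. r t (snd h, a) + (\<integral>s. v s \<partial>P (snd h, a)) \<partial>\<pi> t h)"
    using prob_algebra_integral_const[OF \<pi>h] by simp
qed

lemma bdd_measurable_stage_value:
  assumes P: "P \<in> M \<Otimes>\<^sub>M N \<rightarrow>\<^sub>M prob_algebra M"
    and \<pi>: "\<pi> \<in> policies M N H" and t: "t < H"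
    and q: "q \<in> bdd_measurable (M \<Otimes>\<^sub>M N)"
  shows "(\<lambda>h. \<integral>a. q (snd h, a) \<partial>\<pi> t h) \<in> bdd_measurable (history_space M N t)"
proof (rule bdd_measurable_kernel_integral)
  show "\<pi> t \<in> history_space M N t \<rightarrow>\<^sub>M prob_algebra N" using \<pi> t by (auto simp: policies_def)
  show "(\<lambda>(h, a). q (snd h, a)) \<in> bdd_measurable (history_space M N t \<Otimes>\<^sub>M N)"
    unfolding case_prod_beta' history_space_def by (rule bdd_measurable_compose[OF q]) measurable
qed

section \<open>Verification of value functions\<close>

lemma history_value_0:
  fixes v :: "'s \<Rightarrow> real"
  assumes "s\<^sub>0 \<in> space M" "v \<in> borel_measurable M"
  shows "(\<integral>h. v (snd h) \<partial>history_law M N P s\<^sub>0 \<pi> 0) = v s\<^sub>0"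
proof -
  have "(\<lambda>_. undefined, s\<^sub>0) \<in> space (history_space M N 0)"
    using assms(1) by (simp add: history_space_def space_pair_measure space_PiM)
  moreover have "(\<lambda>h. v (snd h)) \<in> borel_measurable (history_space M N 0)"
    using assms(2) unfolding history_space_def by measurable
  ultimately show ?thesis
    unfolding history_law.simps
    using integral_return[of "(\<lambda>_. undefined, s\<^sub>0)" "history_space M N 0" "\<lambda>h. v (snd h)"] by simp
qed

text \<open>Reward collected so far plus \<open>v t\<close> at the current state is a
  supermartingale when the stage returns are dominated by \<open>v\<close>. The inequality is stated
  for each history, so history-dependent policies are covered.\<close>

lemma history_value_le:
  assumes P: "P \<in> M \<Otimes>\<^sub>M N \<rightarrow>\<^sub>M prob_algebra M" and s\<^sub>0: "s\<^sub>0 \<in> space M"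
    and \<pi>: "\<pi> \<in> policies M N H"
    and r: "\<And>i. r i \<in> bdd_measurable (M \<Otimes>\<^sub>M N)" and v: "\<And>i. v i \<in> bdd_measurable M"
    and le: "\<And>t h. t < H \<Longrightarrow> h \<in> space (history_space M N t) \<Longrightarrow>
      (\<integral>a. r t (snd h, a) + (\<integral>s. v (Suc t) s \<partial>P (snd h, a)) \<partial>\<pi> t h) \<le> v t (snd h)"
  shows "(\<integral>h. (\<Sum>i<H. r i (fst h i)) + v H (snd h) \<partial>history_law M N P s\<^sub>0 \<pi> H) \<le> v 0 s\<^sub>0"
proof -
  have "t \<le> H \<Longrightarrow> (\<integral>h. (\<Sum>i<t. r i (fst h i)) + v t (snd h) \<partial>history_law M N P s\<^sub>0 \<pi> t) \<le> v 0 s\<^sub>0" for t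
  proof (induction t)
    case 0
    show ?case using history_value_0[OF s\<^sub>0 bdd_measurableD[OF v], of N P \<pi> 0] by (simp del: history_law.simps)
  next
    case (Suc t)
    then have t: "t < H" by simp
    have "(\<integral>h. (\<Sum>i<Suc t. r i (fst h i)) + v (Suc t) (snd h) \<partial>history_law M N P s\<^sub>0 \<pi> (Suc t)) =
      (\<integral>h. (\<Sum>i<t. r i (fst h i)) + (\<integral>a. r t (snd h, a) + (\<integral>s. v (Suc t) s \<partial>P (snd h, a)) \<partial>\<pi> t h)
        \<partial>history_law M N P s\<^sub>0 \<pi> t)"
      by (rule history_value_Suc[OF P s\<^sub>0 \<pi> t r v])
    also have "\<dots> \<le> (\<integral>h. (\<Sum>i<t. r i (fst h i)) + v t (snd h) \<partial>history_law M N P s\<^sub>0 \<pi> t)"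
    proof (rule prob_algebra_integral_mono[OF history_law_in_prob_algebra[OF P s\<^sub>0 \<pi>]])
      \<comment> \<open>A zero terminal function gives the bound for the sum of rewards
        alone.\<close>
      have "(\<lambda>h. (\<Sum>i<t. r i (fst h i)) + 0) \<in> bdd_measurable (history_space M N t)"
        by (rule bdd_measurable_history_value[OF r bdd_measurable_const])
      then show "(\<lambda>h. (\<Sum>i<t. r i (fst h i)) + (\<integral>a. r t (snd h, a) + (\<integral>s. v (Suc t) s \<partial>P (snd h, a)) \<partial>\<pi> t h))
          \<in> bdd_measurable (history_space M N t)"
        by (intro bdd_measurable_add bdd_measurable_stage_value[OF P \<pi> t, of "\<lambda>z. r t z + (\<integral>s. v (Suc t) s \<partial>P z)"]
            r bdd_measurable_integral_kernel[OF v P]) simp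
    qed (use t le[OF t] bdd_measurable_history_value[OF r v] in auto)
    also have "\<dots> \<le> v 0 s\<^sub>0" using Suc by simp
    finally show ?case .
  qed
  then show ?thesis by simp
qed

text \<open>The martingale case: it evaluates a given policy exactly, and is used for both the
  Lagrangian and the constraint of the mixture.\<close>

lemma history_value_eq:
  assumes P: "P \<in> M \<Otimes>\<^sub>M N \<rightarrow>\<^sub>M prob_algebra M" and s\<^sub>0: "s\<^sub>0 \<in> space M"
    and \<pi>: "\<pi> \<in> policies M N H"
    and r: "\<And>i. r i \<in> bdd_measurable (M \<Otimes>\<^sub>M N)" and v: "\<And>i. v i \<in> bdd_measurable M"
    and eq: "\<And>t h. t < H \<Longrightarrow> h \<in> space (history_space M N t) \<Longrightarrow>
      (\<integral>a. r t (snd h, a) + (\<integral>s. v (Suc t) s \<partial>P (snd h, a)) \<partial>\<pi> t h) = v t (snd h)"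
  shows "(\<integral>h. (\<Sum>i<H. r i (fst h i)) + v H (snd h) \<partial>history_law M N P s\<^sub>0 \<pi> H) = v 0 s\<^sub>0"
proof -
  have "t \<le> H \<Longrightarrow> (\<integral>h. (\<Sum>i<t. r i (fst h i)) + v t (snd h) \<partial>history_law M N P s\<^sub>0 \<pi> t) = v 0 s\<^sub>0" for t
  proof (induction t)
    case 0
    show ?case using history_value_0[OF s\<^sub>0 bdd_measurableD[OF v], of N P \<pi> 0] by (simp del: history_law.simps)
  next
    case (Suc t)
    then have t: "t < H" by simp
    have L: "history_law M N P s\<^sub>0 \<pi> t \<in> space (prob_algebra (history_space M N t))"
      using history_law_in_prob_algebra[OF P s\<^sub>0 \<pi>] t by simp
    have "(\<integral>h. (\<Sum>i<t. r i (fst h i)) + (\<integral>a. r t (snd h, a) + (\<integral>s. v (Suc t) s \<partial>P (snd h, a)) \<partial>\<pi> t h)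
        \<partial>history_law M N P s\<^sub>0 \<pi> t) = (\<integral>h. (\<Sum>i<t. r i (fst h i)) + v t (snd h) \<partial>history_law M N P s\<^sub>0 \<pi> t)"
      by (intro Bochner_Integration.integral_cong refl) (simp add: eq[OF t] prob_algebra_space_eq[OF L])
    then show ?case unfolding history_value_Suc[OF P s\<^sub>0 \<pi> t r v] using Suc by simp
  qed
  then show ?thesis by simp
qed

section \<open>Dynamic programming with compact action sets\<close>

text \<open>Continuity in the action is setwise. \<open>A_nonempty\<close> makes the real suprema
  over \<open>A\<close> meaningful; an empty \<open>A\<close> can only occur with horizon 0 once a
  policy exists, and is treated apart at the end.\<close>

locale compact_mdp =
  fixes M :: "'s measure" and A :: "'a::polish_space set" and P :: "'s \<times> 'a \<Rightarrow> 's measure"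
  assumes P: "P \<in> M \<Otimes>\<^sub>M borel_on A \<rightarrow>\<^sub>M prob_algebra M"
    and compact_A: "compact A" and A_nonempty: "A \<noteq> {}"
    and P_continuous: "\<And>x B. x \<in> space M \<Longrightarrow> B \<in> sets M \<Longrightarrow> continuous_on A (\<lambda>a. measure (P (x, a)) B)"
begin

text \<open>Bounded Caratheodory integrands: over a compact \<open>A\<close> they have measurable
  suprema, attained at every state, and every one-stage return below is of this kind.\<close>

definition caratheodory :: "('s \<times> 'a \<Rightarrow> real) set" where
  "caratheodory = {q \<in> bdd_measurable (M \<Otimes>\<^sub>M borel_on A). \<forall>x\<in>space M. continuous_on A (\<lambda>a. q (x, a))}"

lemma caratheodoryD:
  assumes "q \<in> caratheodory"
  shows "q \<in> bdd_measurable (M \<Otimes>\<^sub>M borel_on A)"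
    "x \<in> space M \<Longrightarrow> continuous_on A (\<lambda>a. q (x, a))"
    "a \<in> A \<Longrightarrow> (\<lambda>x. q (x, a)) \<in> borel_measurable M"
proof -
  show 1: "q \<in> bdd_measurable (M \<Otimes>\<^sub>M borel_on A)" using assms by (simp add: caratheodory_def)
  show "x \<in> space M \<Longrightarrow> continuous_on A (\<lambda>a. q (x, a))" using assms by (simp add: caratheodory_def)
  assume "a \<in> A"
  then show "(\<lambda>x. q (x, a)) \<in> borel_measurable M"
    by (intro measurable_compose[OF _ bdd_measurableD[OF 1]] measurable_Pair2')
      (simp add: space_restrict_space)
qed

lemma caratheodory_add: "q \<in> caratheodory \<Longrightarrow> q' \<in> caratheodory \<Longrightarrow> (\<lambda>z. q z + q' z) \<in> caratheodory"
  unfolding caratheodory_def by (auto intro: bdd_measurable_add continuous_on_add)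

lemma caratheodory_cmult: "q \<in> caratheodory \<Longrightarrow> (\<lambda>z. c * q z) \<in> caratheodory"
  unfolding caratheodory_def by (auto intro: bdd_measurable_cmult continuous_on_mult_left)

lemma caratheodory_fst: "v \<in> bdd_measurable M \<Longrightarrow> (\<lambda>z. v (fst z)) \<in> caratheodory"
  unfolding caratheodory_def by (auto intro: bdd_measurable_compose)

lemma P_in: "x \<in> space M \<Longrightarrow> a \<in> A \<Longrightarrow> P (x, a) \<in> space (prob_algebra M)"
  by (rule measurable_space[OF P]) (simp add: space_pair_measure space_restrict_space)

lemma caratheodory_integral:
  assumes v: "v \<in> bdd_measurable M"
  shows "(\<lambda>z. \<integral>y. v y \<partial>P z) \<in> caratheodory"
proof -
  obtain C where C: "\<And>x. x \<in> space M \<Longrightarrow> \<bar>v x\<bar> \<le> C" using bdd_measurable_bound[OF v] by metis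
  have "continuous_on A (\<lambda>a. \<integral>y. v y \<partial>P (x, a))" if x: "x \<in> space M" for x
    by (rule continuous_on_integral_setwise[where M = M and C = C])
      (use P_in P_continuous x C bdd_measurableD[OF v] in auto)
  then show ?thesis
    using bdd_measurable_integral_kernel[OF v P] by (simp add: caratheodory_def)
qed

lemma SUP_attained:
  assumes "q \<in> caratheodory" "x \<in> space M"
  obtains a where "a \<in> A" "q (x, a) = (SUP a\<in>A. q (x, a))"
proof -
  from continuous_attains_sup[OF compact_A A_nonempty caratheodoryD(2)[OF assms]]
  obtain a where a: "a \<in> A" "\<forall>b\<in>A. q (x, b) \<le> q (x, a)" by blast
  then have "(SUP a\<in>A. q (x, a)) = q (x, a)" by (intro cSup_eq_maximum) auto
  with a show ?thesis by (intro that[of a]) auto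
qed

lemma SUP_upper_caratheodory:
  assumes "q \<in> caratheodory" "x \<in> space M" "a \<in> A"
  shows "q (x, a) \<le> (SUP a\<in>A. q (x, a))"
  by (intro cSUP_upper assms bounded_imp_bdd_above compact_imp_bounded compact_continuous_image
      caratheodoryD(2) compact_A)

lemma bdd_measurable_SUP:
  assumes q: "q \<in> caratheodory"
  shows "(\<lambda>x. SUP a\<in>A. q (x, a)) \<in> bdd_measurable M"
proof -
  obtain C where C: "\<And>z. z \<in> space (M \<Otimes>\<^sub>M borel_on A) \<Longrightarrow> \<bar>q z\<bar> \<le> C"
    using bdd_measurable_bound[OF caratheodoryD(1)[OF q]] by metis
  show ?thesis
  proof (rule bdd_measurableI)
    show "(\<lambda>x. SUP a\<in>A. q (x, a)) \<in> borel_measurable M"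
      by (rule borel_measurable_SUP_compact[OF compact_A A_nonempty])
        (use caratheodoryD[OF q] in auto)
    fix x assume x: "x \<in> space M"
    obtain a where a: "a \<in> A" "q (x, a) = (SUP a\<in>A. q (x, a))"
      using SUP_attained[OF q x] by blast
    then show "\<bar>SUP a\<in>A. q (x, a)\<bar> \<le> C"
      using C[of "(x, a)"] x by (simp add: space_pair_measure space_restrict_space)
  qed
qed

text \<open>\<open>value_iter q u k\<close> is the optimal value with \<open>k\<close> stages to go; the reward sequence \<open>q\<close> is indexed
  by the number of stages that remain afterwards.\<close>

primrec value_iter :: "(nat \<Rightarrow> 's \<times> 'a \<Rightarrow> real) \<Rightarrow> ('s \<Rightarrow> real) \<Rightarrow> nat \<Rightarrow> 's \<Rightarrow> real" where
  "value_iter q u 0 = u"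
| "value_iter q u (Suc k) = (\<lambda>x. SUP a\<in>A. q k (x, a) + (\<integral>y. value_iter q u k y \<partial>P (x, a)))"

text \<open>The advantage function: it is nonpositive, and its zeros in \<open>A\<close> are the
  optimal actions with \<open>Suc k\<close> stages to go.\<close>

definition gap :: "(nat \<Rightarrow> 's \<times> 'a \<Rightarrow> real) \<Rightarrow> ('s \<Rightarrow> real) \<Rightarrow> nat \<Rightarrow> 's \<times> 'a \<Rightarrow> real" where
  "gap q u k z = q k z + (\<integral>y. value_iter q u k y \<partial>P z) - value_iter q u (Suc k) (fst z)"

text \<open>Lexicographic dynamic programming: \<open>w\<close> is a secondary terminal objective,
  pursued only through actions that are optimal for the primary problem \<open>q\<close>,
  \<open>u\<close>.\<close>

primrec lex_iter ::
    "(nat \<Rightarrow> 's \<times> 'a \<Rightarrow> real) \<Rightarrow> ('s \<Rightarrow> real) \<Rightarrow> ('s \<Rightarrow> real) \<Rightarrow> nat \<Rightarrow> 's \<Rightarrow> real" where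
  "lex_iter q u w 0 = w"
| "lex_iter q u w (Suc k) =
     (\<lambda>x. SUP a\<in>{a \<in> A. gap q u k (x, a) = 0}. \<integral>y. lex_iter q u w k y \<partial>P (x, a))"

context
  fixes q :: "nat \<Rightarrow> 's \<times> 'a \<Rightarrow> real" and u :: "'s \<Rightarrow> real"
  assumes q: "\<And>k. q k \<in> caratheodory" and u: "u \<in> bdd_measurable M"
begin

lemma bdd_measurable_value_iter: "value_iter q u k \<in> bdd_measurable M"
  by (induction k) (auto intro!: u q bdd_measurable_SUP[of "\<lambda>z. q _ z + (\<integral>y. value_iter q u _ y \<partial>P z)"]
    caratheodory_add caratheodory_integral)

lemma caratheodory_stage: "(\<lambda>z. q k z + (\<integral>y. value_iter q u k y \<partial>P z)) \<in> caratheodory"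
  by (intro caratheodory_add caratheodory_integral q bdd_measurable_value_iter)

lemma caratheodory_gap: "gap q u k \<in> caratheodory"
proof -
  have "(\<lambda>z. (q k z + (\<integral>y. value_iter q u k y \<partial>P z)) + (- 1) * value_iter q u (Suc k) (fst z)) \<in> caratheodory"
    by (intro caratheodory_add[OF caratheodory_stage] caratheodory_cmult caratheodory_fst
        bdd_measurable_value_iter)
  then show ?thesis by (simp add: gap_def[abs_def])
qed

lemma gap_le_0: "x \<in> space M \<Longrightarrow> a \<in> A \<Longrightarrow> gap q u k (x, a) \<le> 0"
  using SUP_upper_caratheodory[OF caratheodory_stage] by (simp add: gap_def)

lemma gap_eq_0: "x \<in> space M \<Longrightarrow> \<exists>a\<in>A. gap q u k (x, a) = 0"
  using SUP_attained[OF caratheodory_stage[of k]] by (force simp: gap_def)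

end

text \<open>The Bellman operator is monotone and commutes with adding a constant. The estimate is
  one-sided; used in both directions it gives the Lipschitz bound for the dual function.\<close>

lemma value_iter_lipschitz:
  assumes q: "\<And>k. q k \<in> caratheodory" and u: "u \<in> bdd_measurable M" "u' \<in> bdd_measurable M"
    and le: "\<And>x. x \<in> space M \<Longrightarrow> u x \<le> u' x + C"
  shows "x \<in> space M \<Longrightarrow> value_iter q u k x \<le> value_iter q u' k x + C"
proof (induction k arbitrary: x)
  case 0
  then show ?case using le by simp
next
  case (Suc k)
  note b = bdd_measurable_value_iter[where q = q, OF q u(1)] bdd_measurable_value_iter[where q = q, OF q u(2)]
  note stage = caratheodory_stage[where q = q, OF q u(2)]
  show ?case
    unfolding value_iter.simps
  proof (rule cSUP_least[OF A_nonempty])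
    fix a assume a: "a \<in> A"
    note Pxa = P_in[OF Suc.prems a]
    have "(\<integral>y. value_iter q u k y \<partial>P (x, a)) \<le> (\<integral>y. value_iter q u' k y + C \<partial>P (x, a))"
      by (rule prob_algebra_integral_mono[OF Pxa])
        (use Suc b bdd_measurable_add[OF b(2) bdd_measurable_const] in auto)
    also have "\<dots> = (\<integral>y. value_iter q u' k y \<partial>P (x, a)) + C"
      by (simp only: Bochner_Integration.integral_add[OF bdd_measurable_integrable[OF Pxa b(2)]
          bdd_measurable_integrable[OF Pxa bdd_measurable_const]] prob_algebra_integral_const[OF Pxa])
    finally show "q k (x, a) + (\<integral>y. value_iter q u k y \<partial>P (x, a)) \<le>
        (SUP a\<in>A. q k (x, a) + (\<integral>y. value_iter q u' k y \<partial>P (x, a))) + C"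
      using SUP_upper_caratheodory[OF stage Suc.prems a, of k] by simp
  qed
qed

section \<open>Lexicographic optimality and difference quotients\<close>

context
  fixes q :: "nat \<Rightarrow> 's \<times> 'a \<Rightarrow> real" and u w :: "'s \<Rightarrow> real"
  assumes q: "\<And>k. q k \<in> caratheodory" and u: "u \<in> bdd_measurable M" and w: "w \<in> bdd_measurable M"
begin

lemma bdd_measurable_lex_iter: "lex_iter q u w k \<in> bdd_measurable M"
proof (induction k)
  case 0
  show ?case using w by simp
next
  case (Suc k)
  obtain C where C: "\<And>x. x \<in> space M \<Longrightarrow> \<bar>lex_iter q u w k x\<bar> \<le> C"
    using bdd_measurable_bound[OF Suc] by metis
  note g = caratheodoryD[OF caratheodory_gap[where q = q, OF q u, of k]]
  note v = caratheodoryD[OF caratheodory_integral[OF Suc]]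
  show ?case
    unfolding lex_iter.simps
  proof (rule bdd_measurableI)
    show "(\<lambda>x. SUP a\<in>{a \<in> A. gap q u k (x, a) = 0}. \<integral>y. lex_iter q u w k y \<partial>P (x, a)) \<in> borel_measurable M"
      using g v gap_le_0[where q = q, OF q u] gap_eq_0[where q = q, OF q u]
      by (intro borel_measurable_constrained_SUP[OF compact_A]) auto
    fix x assume x: "x \<in> space M"
    show "\<bar>SUP a\<in>{a \<in> A. gap q u k (x, a) = 0}. \<integral>y. lex_iter q u w k y \<partial>P (x, a)\<bar> \<le> C"
    proof (rule cSup_abs_le)
      show "(\<lambda>a. \<integral>y. lex_iter q u w k y \<partial>P (x, a)) ` {a \<in> A. gap q u k (x, a) = 0} \<noteq> {}"
        using gap_eq_0[where q = q, OF q u x] by auto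
      fix z assume "z \<in> (\<lambda>a. \<integral>y. lex_iter q u w k y \<partial>P (x, a)) ` {a \<in> A. gap q u k (x, a) = 0}"
      then show "\<bar>z\<bar> \<le> C"
        using prob_algebra_integral_abs_le[OF P_in[OF x] Suc] C by auto
    qed
  qed
qed

lemma lex_selector:
  obtains \<phi> where "\<phi> \<in> M \<rightarrow>\<^sub>M borel_on A" "\<And>x. x \<in> space M \<Longrightarrow> gap q u k (x, \<phi> x) = 0"
    "\<And>x. x \<in> space M \<Longrightarrow> (\<integral>y. lex_iter q u w k y \<partial>P (x, \<phi> x)) = lex_iter q u w (Suc k) x"
proof -
  \<comment> \<open>Both summands are nonnegative on \<open>A\<close>, so a zero of
    \<open>h x\<close> is an action that is optimal for the primary problem and at the same time
    attains the secondary value.\<close>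
  define h where "h x a = - gap q u k (x, a) +
    \<bar>(\<integral>y. lex_iter q u w k y \<partial>P (x, a)) - lex_iter q u w (Suc k) x\<bar>" for x a
  note g = caratheodoryD[OF caratheodory_gap[where q = q, OF q u, of k]]
  note v = caratheodoryD[OF caratheodory_integral[OF bdd_measurable_lex_iter[of k]]]
  note gap = gap_le_0[where q = q, OF q u] gap_eq_0[where q = q, OF q u]
  obtain \<phi> where \<phi>: "\<phi> \<in> M \<rightarrow>\<^sub>M borel_on A" "\<And>x. x \<in> space M \<Longrightarrow> h x (\<phi> x) = 0"
  proof (rule measurable_zero_selection[OF compact_A, of h M])
    fix a assume "a \<in> A"
    then show "(\<lambda>x. h x a) \<in> borel_measurable M"
      unfolding h_def using g(3) v(3) bdd_measurableD[OF bdd_measurable_lex_iter[of "Suc k"]]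
      by (intro borel_measurable_add borel_measurable_uminus borel_measurable_abs borel_measurable_diff)
  next
    fix x assume "x \<in> space M"
    then show "continuous_on A (h x)"
      unfolding h_def using g(2) v(2) by (intro continuous_intros)
  next
    fix x a assume "x \<in> space M" "a \<in> A"
    then show "0 \<le> h x a" unfolding h_def using gap(1)[of x a k] by simp
  next
    fix x assume x: "x \<in> space M"
    let ?Z = "{a \<in> A. gap q u k (x, a) = 0}"
    have Z: "compact ?Z" "?Z \<noteq> {}"
      using compact_level_set[OF compact_A g(2)[OF x]] gap(2)[OF x] by auto
    have "continuous_on ?Z (\<lambda>a. \<integral>y. lex_iter q u w k y \<partial>P (x, a))"
      by (rule continuous_on_subset[OF v(2)[OF x]]) auto
    from continuous_attains_sup[OF Z this]
    obtain a where a: "a \<in> ?Z"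
      "\<forall>b\<in>?Z. (\<integral>y. lex_iter q u w k y \<partial>P (x, b)) \<le> (\<integral>y. lex_iter q u w k y \<partial>P (x, a))"
      by (elim bexE)
    then have "lex_iter q u w (Suc k) x = (\<integral>y. lex_iter q u w k y \<partial>P (x, a))"
      unfolding lex_iter.simps by (intro cSup_eq_maximum) auto
    then show "\<exists>a\<in>A. h x a = 0" using a(1) by (intro bexI[of _ a]) (auto simp: h_def)
  qed blast
  have "gap q u k (x, \<phi> x) = 0 \<and> (\<integral>y. lex_iter q u w k y \<partial>P (x, \<phi> x)) = lex_iter q u w (Suc k) x"
    if x: "x \<in> space M" for x
  proof -
    have "\<phi> x \<in> A" using measurable_space[OF \<phi>(1) x] by (simp add: space_restrict_space)
    then show ?thesis using \<phi>(2)[OF x] gap(1)[OF x, of "\<phi> x" k] unfolding h_def by linarith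
  qed
  then show ?thesis using \<phi>(1) by (intro that) auto
qed

lemma lex_selectors:
  obtains \<phi> where "\<And>k. \<phi> k \<in> M \<rightarrow>\<^sub>M borel_on A" "\<And>k x. x \<in> space M \<Longrightarrow> gap q u k (x, \<phi> k x) = 0"
    "\<And>k x. x \<in> space M \<Longrightarrow> (\<integral>y. lex_iter q u w k y \<partial>P (x, \<phi> k x)) = lex_iter q u w (Suc k) x"
proof -
  define good where "good k \<phi> \<longleftrightarrow> \<phi> \<in> M \<rightarrow>\<^sub>M borel_on A \<and> (\<forall>x\<in>space M. gap q u k (x, \<phi> x) = 0) \<and>
    (\<forall>x\<in>space M. (\<integral>y. lex_iter q u w k y \<partial>P (x, \<phi> x)) = lex_iter q u w (Suc k) x)" for k \<phi>
  have "\<exists>\<phi>. good k \<phi>" for k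
    by (rule lex_selector[of k]) (auto simp only: good_def)
  then have "good k ((\<lambda>k. SOME \<phi>. good k \<phi>) k)" for k
    by (rule someI_ex)
  then show ?thesis
    by (intro that[of "\<lambda>k. SOME \<phi>. good k \<phi>"]) (unfold good_def, blast+)
qed

text \<open>
  \<open>penalized n\<close> is the difference quotient of the optimal value when the terminal value \<open>u\<close> moves by
  \<open>w / n\<close> (\<open>value_iter_perturb\<close>); it decreases to the lexicographic value as \<open>n\<close> grows.
\<close>

abbreviation penalized :: "nat \<Rightarrow> nat \<Rightarrow> 's \<Rightarrow> real" where
  "penalized n \<equiv> value_iter (\<lambda>k z. real n * gap q u k z) w"

lemma bdd_measurable_penalized: "penalized n k \<in> bdd_measurable M"
  by (intro bdd_measurable_value_iter caratheodory_cmult caratheodory_gap q u w)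

lemma penalized_decreasing: "x \<in> space M \<Longrightarrow> penalized (Suc n) k x \<le> penalized n k x"
proof (induction k arbitrary: x)
  case 0
  then show ?case by simp
next
  case (Suc k)
  have stage: "(\<lambda>z. real n * gap q u k z + (\<integral>y. penalized n k y \<partial>P z)) \<in> caratheodory" for n
    by (intro caratheodory_add caratheodory_cmult caratheodory_gap caratheodory_integral
        bdd_measurable_penalized q u)
  show ?case
    unfolding value_iter.simps(2)
  proof (rule cSUP_least[OF A_nonempty])
    fix a assume a: "a \<in> A"
    have "(\<integral>y. penalized (Suc n) k y \<partial>P (x, a)) \<le> (\<integral>y. penalized n k y \<partial>P (x, a))"
      by (rule prob_algebra_integral_mono[OF P_in[OF Suc.prems a]])
        (use Suc.IH bdd_measurable_penalized in \<open>auto simp del: of_nat_Suc\<close>)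
    moreover have "real (Suc n) * gap q u k (x, a) \<le> real n * gap q u k (x, a)"
      using gap_le_0[where q = q, OF q u Suc.prems a, of k] by (simp add: algebra_simps)
    ultimately show "real (Suc n) * gap q u k (x, a) + (\<integral>y. penalized (Suc n) k y \<partial>P (x, a)) \<le>
        (SUP a\<in>A. real n * gap q u k (x, a) + (\<integral>y. penalized n k y \<partial>P (x, a)))"
      using SUP_upper_caratheodory[OF stage[of n] Suc.prems a] by linarith
  qed
qed

text \<open>Dominated convergence carries the limit through the transition kernel, and the penalty
  argument carries it through the supremum, where the weight \<open>real n\<close> leaves only the
  zeros of \<open>gap\<close>.\<close>

lemma penalized_tendsto: "x \<in> space M \<Longrightarrow> (\<lambda>n. penalized n k x) \<longlonglongrightarrow> lex_iter q u w k x"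
proof (induction k arbitrary: x)
  case 0
  then show ?case by simp
next
  case (Suc k)
  have dec: "decseq (\<lambda>n. penalized n k y)" if "y \<in> space M" for y
    by (rule decseq_SucI) (rule penalized_decreasing[OF that])
  obtain C where C: "\<And>y. y \<in> space M \<Longrightarrow> \<bar>lex_iter q u w k y\<bar> \<le> C"
    using bdd_measurable_bound[OF bdd_measurable_lex_iter] by metis
  obtain D where D: "\<And>y. y \<in> space M \<Longrightarrow> \<bar>penalized 0 k y\<bar> \<le> D"
    using bdd_measurable_bound[OF bdd_measurable_penalized] by metis
  \<comment> \<open>A decreasing sequence lies between its limit and its first term, which gives a
    bound uniform in \<open>n\<close>.\<close>
  have bound: "\<bar>penalized n k y\<bar> \<le> max C D" if y: "y \<in> space M" for n y
    using decseq_ge[OF dec[OF y] Suc.IH[OF y], of n] decseqD[OF dec[OF y], of 0 n] C[OF y] D[OF y]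
    by simp
  have "(\<lambda>n. \<integral>y. penalized n k y \<partial>P (x, a)) \<longlonglongrightarrow> (\<integral>y. lex_iter q u w k y \<partial>P (x, a))"
    if a: "a \<in> A" for a
  proof (rule integral_dominated_convergence[where w = "\<lambda>_. max C D"])
    note Pxa = P_in[OF Suc.prems a]
    show "lex_iter q u w k \<in> borel_measurable (P (x, a))" "penalized n k \<in> borel_measurable (P (x, a))" for n
      using bdd_measurable_lex_iter bdd_measurable_penalized
      by (auto simp: prob_algebra_measurable_eq[OF Pxa] dest: bdd_measurableD)
    show "integrable (P (x, a)) (\<lambda>_. max C D)"
      by (rule bdd_measurable_integrable[OF Pxa bdd_measurable_const])
    show "AE y in P (x, a). (\<lambda>n. penalized n k y) \<longlonglongrightarrow> lex_iter q u w k y"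
      "AE y in P (x, a). norm (penalized n k y) \<le> max C D" for n
      using Suc.IH bound by (auto simp: prob_algebra_space_eq[OF Pxa])
  qed
  moreover have "(\<integral>y. penalized (Suc n) k y \<partial>P (x, a)) \<le> (\<integral>y. penalized n k y \<partial>P (x, a))"
    if "a \<in> A" for a n
    by (rule prob_algebra_integral_mono[OF P_in[OF Suc.prems that]])
      (use penalized_decreasing bdd_measurable_penalized in \<open>auto simp del: of_nat_Suc\<close>)
  ultimately show ?case
    unfolding value_iter.simps(2) lex_iter.simps(2)
    using gap_le_0[where q = q, OF q u Suc.prems] gap_eq_0[where q = q, OF q u Suc.prems]
      caratheodoryD(2)[OF caratheodory_gap[where q = q, OF q u] Suc.prems]
      caratheodoryD(2)[OF caratheodory_integral[OF bdd_measurable_penalized] Suc.prems]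
    by (intro penalized_sup_tendsto[OF compact_A])
qed

text \<open>An exact identity, not an expansion. Subtracting the unperturbed value from the
  perturbed Bellman equation and multiplying by \<open>real (Suc n)\<close> leaves a Bellman
  equation with terminal value \<open>w\<close> and stage reward \<open>real (Suc n)\<close> times
  \<open>gap\<close>. The successor keeps the divisor positive.\<close>

lemma value_iter_perturb:
  assumes "x \<in> space M"
  shows "value_iter q (\<lambda>x. u x + w x / real (Suc n)) k x =
    value_iter q u k x + penalized (Suc n) k x / real (Suc n)"
  using assms
proof (induction k arbitrary: x)
  case 0
  then show ?case by simp
next
  case (Suc k)
  let ?W = "penalized (Suc n) k" and ?m = "real (Suc n)"
  have stage: "(\<lambda>z. ?m * gap q u k z + (\<integral>y. ?W y \<partial>P z)) \<in> caratheodory"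
    by (intro caratheodory_add caratheodory_cmult caratheodory_gap caratheodory_integral
        bdd_measurable_penalized q u)
  have eq: "q k (x, a) + (\<integral>y. value_iter q (\<lambda>x. u x + w x / ?m) k y \<partial>P (x, a)) =
      value_iter q u (Suc k) x + (?m * gap q u k (x, a) + (\<integral>y. ?W y \<partial>P (x, a))) / ?m" if a: "a \<in> A" for a
  proof -
    note Pxa = P_in[OF Suc.prems a]
    have "(\<integral>y. value_iter q (\<lambda>x. u x + w x / ?m) k y \<partial>P (x, a)) =
        (\<integral>y. value_iter q u k y + ?W y / ?m \<partial>P (x, a))"
      by (intro Bochner_Integration.integral_cong refl) (simp only: prob_algebra_space_eq[OF Pxa] Suc.IH)
    also have "\<dots> = (\<integral>y. value_iter q u k y \<partial>P (x, a)) + (\<integral>y. ?W y \<partial>P (x, a)) / ?m"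
      using bdd_measurable_integrable[OF Pxa bdd_measurable_value_iter[where q = q, OF q u]]
        bdd_measurable_integrable[OF Pxa bdd_measurable_penalized]
      by (subst Bochner_Integration.integral_add) (auto simp del: of_nat_Suc)
    finally show ?thesis by (simp add: gap_def add_divide_distrib del: of_nat_Suc value_iter.simps)
  qed
  show ?case
  proof (subst value_iter.simps(2), rule cSup_eq_maximum)
    obtain a where a: "a \<in> A" "?m * gap q u k (x, a) + (\<integral>y. ?W y \<partial>P (x, a)) = penalized (Suc n) (Suc k) x"
      using SUP_attained[OF stage Suc.prems] by auto
    show "value_iter q u (Suc k) x + penalized (Suc n) (Suc k) x / ?m
        \<in> (\<lambda>a. q k (x, a) + (\<integral>y. value_iter q (\<lambda>x. u x + w x / ?m) k y \<partial>P (x, a))) ` A"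
      using a(1) by (rule image_eqI[rotated]) (simp only: eq[OF a(1)] a(2))
  next
    fix z assume "z \<in> (\<lambda>a. q k (x, a) + (\<integral>y. value_iter q (\<lambda>x. u x + w x / ?m) k y \<partial>P (x, a))) ` A"
    then obtain a where a: "a \<in> A" and z: "z = q k (x, a) + (\<integral>y. value_iter q (\<lambda>x. u x + w x / ?m) k y \<partial>P (x, a))"
      by blast
    have "?m * gap q u k (x, a) + (\<integral>y. ?W y \<partial>P (x, a)) \<le> penalized (Suc n) (Suc k) x"
      using SUP_upper_caratheodory[OF stage Suc.prems a] by simp
    then show "z \<le> value_iter q u (Suc k) x + penalized (Suc n) (Suc k) x / ?m"
      unfolding z eq[OF a] by (intro add_left_mono divide_right_mono) auto
  qed
qed

text \<open>A lower bound on all late difference quotients bounds their limit, a one-sided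
  derivative. Taking \<open>w\<close> to be the constraint function or its negative covers the right
  and the left derivative.\<close>

lemma lex_iter_ge:
  assumes x: "x \<in> space M"
    and le: "\<forall>\<^sub>F n in sequentially. value_iter q u k x + c / real (Suc n) \<le>
      value_iter q (\<lambda>x. u x + w x / real (Suc n)) k x"
  shows "c \<le> lex_iter q u w k x"
proof (rule LIMSEQ_le_const[OF LIMSEQ_Suc[OF penalized_tendsto[OF x]]])
  have "c \<le> penalized (Suc n) k x"
    if "value_iter q u k x + c / real (Suc n) \<le> value_iter q (\<lambda>x. u x + w x / real (Suc n)) k x" for n
    using that unfolding value_iter_perturb[OF x] by (simp add: divide_le_cancel del: of_nat_Suc)
  with le show "\<exists>N. \<forall>n\<ge>N. c \<le> penalized (Suc n) k x"
    unfolding eventually_sequentially by blast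
qed

end

end

section \<open>Lagrangian duality\<close>

text \<open>Written as the image of a coin toss, so that measurability in the state is inherited
  from the two selectors; for \<theta> in the unit interval, \<theta> is the probability of
  \<open>\<psi>\<close>.\<close>

definition mixed_kernel :: "'a measure \<Rightarrow> real \<Rightarrow> ('s \<Rightarrow> 'a) \<Rightarrow> ('s \<Rightarrow> 'a) \<Rightarrow> 's \<Rightarrow> 'a measure" where
  "mixed_kernel N \<theta> \<phi> \<psi> x = distr (measure_pmf (bernoulli_pmf \<theta>)) N (\<lambda>b. if b then \<psi> x else \<phi> x)"

lemma measurable_mixed_kernel:
  assumes [measurable]: "\<phi> \<in> M \<rightarrow>\<^sub>M N" "\<psi> \<in> M \<rightarrow>\<^sub>M N"
  shows "mixed_kernel N \<theta> \<phi> \<psi> \<in> M \<rightarrow>\<^sub>M prob_algebra N"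
proof -
  have "(\<lambda>_. measure_pmf (bernoulli_pmf \<theta>)) \<in> M \<rightarrow>\<^sub>M prob_algebra (count_space UNIV)"
    by (rule measurable_const) (simp add: space_prob_algebra prob_space_measure_pmf)
  moreover have "(\<lambda>(x, b). if b then \<psi> x else \<phi> x) \<in> M \<Otimes>\<^sub>M count_space UNIV \<rightarrow>\<^sub>M N"
    by measurable
  ultimately show ?thesis
    unfolding mixed_kernel_def[abs_def] by (rule measurable_distr_prob_space2)
qed

lemma integral_mixed_kernel:
  assumes \<theta>: "0 \<le> \<theta>" "\<theta> \<le> 1" and f: "f \<in> borel_measurable N" and x: "\<phi> x \<in> space N" "\<psi> x \<in> space N"
  shows "(\<integral>a. f a \<partial>mixed_kernel N \<theta> \<phi> \<psi> x) = (1 - \<theta>) * f (\<phi> x) + \<theta> * (f (\<psi> x) :: real)"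
proof -
  have "(\<integral>a. f a \<partial>mixed_kernel N \<theta> \<phi> \<psi> x) = (\<integral>b. f (if b then \<psi> x else \<phi> x) \<partial>bernoulli_pmf \<theta>)"
    unfolding mixed_kernel_def by (rule integral_distr) (use x f in auto)
  then show ?thesis using \<theta> by simp
qed

section \<open>Stagewise mixtures of two selectors\<close>

context compact_mdp
begin

abbreviation (input) "N \<equiv> borel_on A"

text \<open>Expected terminal \<open>c\<close> with \<open>k\<close> stages to go, when an
  independent coin decides between \<open>\<phi>\<close> and \<open>\<psi>\<close> at each
  stage.\<close>

primrec mixed_value ::
    "('s \<Rightarrow> real) \<Rightarrow> (nat \<Rightarrow> 's \<Rightarrow> 'a) \<Rightarrow> (nat \<Rightarrow> 's \<Rightarrow> 'a) \<Rightarrow> real \<Rightarrow> nat \<Rightarrow> 's \<Rightarrow> real" where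
  "mixed_value c \<phi> \<psi> \<theta> 0 = c"
| "mixed_value c \<phi> \<psi> \<theta> (Suc k) = (\<lambda>x.
     (1 - \<theta>) * (\<integral>y. mixed_value c \<phi> \<psi> \<theta> k y \<partial>P (x, \<phi> k x)) +
     \<theta> * (\<integral>y. mixed_value c \<phi> \<psi> \<theta> k y \<partial>P (x, \<psi> k x)))"

lemma P_selector: "\<phi> \<in> M \<rightarrow>\<^sub>M N \<Longrightarrow> (\<lambda>x. P (x, \<phi> x)) \<in> M \<rightarrow>\<^sub>M prob_algebra M"
  by (rule measurable_compose[OF _ P]) measurable

lemma mixed_value_bounds:
  assumes c: "c \<in> borel_measurable M" "\<And>x. x \<in> space M \<Longrightarrow> c x \<in> {0..1}"
    and \<phi>: "\<And>k. \<phi> k \<in> M \<rightarrow>\<^sub>M N" and \<psi>: "\<And>k. \<psi> k \<in> M \<rightarrow>\<^sub>M N" and \<theta>: "\<theta> \<in> {0..1}"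
  shows "mixed_value c \<phi> \<psi> \<theta> k \<in> bdd_measurable M \<and> (\<forall>x\<in>space M. mixed_value c \<phi> \<psi> \<theta> k x \<in> {0..1})"
proof (induction k)
  case 0
  show ?case using c by (auto intro!: bdd_measurableI[of _ _ 1])
next
  case (Suc k)
  let ?v = "mixed_value c \<phi> \<psi> \<theta> k"
  have int: "(\<integral>y. ?v y \<partial>\<mu>) \<in> {0..1}" if \<mu>: "\<mu> \<in> space (prob_algebra M)" for \<mu>
    using prob_algebra_integral_mono[OF \<mu>, of "\<lambda>_. 0" ?v] prob_algebra_integral_mono[OF \<mu>, of ?v "\<lambda>_. 1"]
      Suc prob_algebra_integral_const[OF \<mu>, of 1] by (auto simp: bdd_measurable_const)
  have "mixed_value c \<phi> \<psi> \<theta> (Suc k) \<in> bdd_measurable M"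
    unfolding mixed_value.simps using Suc
    by (intro bdd_measurable_add bdd_measurable_cmult bdd_measurable_integral_kernel[OF _ P_selector] \<phi> \<psi>) auto
  moreover have "mixed_value c \<phi> \<psi> \<theta> (Suc k) x \<in> {0..1}" if x: "x \<in> space M" for x
  proof -
    have "(\<integral>y. ?v y \<partial>P (x, \<phi> k x)) \<in> {0..1}" "(\<integral>y. ?v y \<partial>P (x, \<psi> k x)) \<in> {0..1}"
      by (rule int, rule measurable_space[OF P_selector[OF \<phi>] x],
          rule int, rule measurable_space[OF P_selector[OF \<psi>] x])
    then show ?thesis
      using \<theta> convexD[OF convex_real_interval(5)[of 0 1], of _ _ "1 - \<theta>" \<theta>] by simp
  qed
  ultimately show ?case by blast
qed

text \<open>Continuity is proved along sequences, so that dominated convergence, with the constant 1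
  as bound, handles the integral of each stage.\<close>

lemma continuous_on_mixed_value:
  assumes c: "c \<in> borel_measurable M" "\<And>x. x \<in> space M \<Longrightarrow> c x \<in> {0..1}"
    and \<phi>: "\<And>k. \<phi> k \<in> M \<rightarrow>\<^sub>M N" and \<psi>: "\<And>k. \<psi> k \<in> M \<rightarrow>\<^sub>M N"
  shows "x \<in> space M \<Longrightarrow> continuous_on {0..1} (\<lambda>\<theta>. mixed_value c \<phi> \<psi> \<theta> k x)"
proof (induction k arbitrary: x)
  case 0
  show ?case by simp
next
  case (Suc k)
  note b = mixed_value_bounds[where c = c and \<phi> = \<phi> and \<psi> = \<psi> and k = k, OF c \<phi> \<psi>]
  have "continuous_on {0..1} (\<lambda>\<theta>. \<integral>y. mixed_value c \<phi> \<psi> \<theta> k y \<partial>\<mu>)"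
    if \<mu>: "\<mu> \<in> space (prob_algebra M)" for \<mu>
    unfolding continuous_on_sequentially comp_def
  proof (intro allI ballI impI, elim conjE)
    fix \<theta>s :: "nat \<Rightarrow> real" and \<theta>
    assume \<theta>: "\<theta> \<in> {0..1}" and \<theta>s: "\<forall>n. \<theta>s n \<in> {0..1}" and lim: "\<theta>s \<longlonglongrightarrow> \<theta>"
    show "(\<lambda>n. \<integral>y. mixed_value c \<phi> \<psi> (\<theta>s n) k y \<partial>\<mu>) \<longlonglongrightarrow> (\<integral>y. mixed_value c \<phi> \<psi> \<theta> k y \<partial>\<mu>)"
    proof (rule integral_dominated_convergence[where w = "\<lambda>_. 1"])
      show "mixed_value c \<phi> \<psi> \<theta> k \<in> borel_measurable \<mu>" "mixed_value c \<phi> \<psi> (\<theta>s n) k \<in> borel_measurable \<mu>" for n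
        using b[of \<theta>] b[of "\<theta>s n"] \<theta> \<theta>s by (auto simp: prob_algebra_measurable_eq[OF \<mu>] dest: bdd_measurableD)
      show "integrable \<mu> (\<lambda>_. 1 :: real)" by (rule bdd_measurable_integrable[OF \<mu> bdd_measurable_const])
      show "AE y in \<mu>. (\<lambda>n. mixed_value c \<phi> \<psi> (\<theta>s n) k y) \<longlonglongrightarrow> mixed_value c \<phi> \<psi> \<theta> k y"
      proof (rule AE_I2)
        fix y assume "y \<in> space \<mu>"
        then have "y \<in> space M" by (simp add: prob_algebra_space_eq[OF \<mu>])
        from Suc.IH[OF this] \<theta> \<theta>s lim
        show "(\<lambda>n. mixed_value c \<phi> \<psi> (\<theta>s n) k y) \<longlonglongrightarrow> mixed_value c \<phi> \<psi> \<theta> k y"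
          unfolding continuous_on_sequentially comp_def by blast
      qed
      show "AE y in \<mu>. norm (mixed_value c \<phi> \<psi> (\<theta>s n) k y) \<le> 1" for n
        using b[of "\<theta>s n"] \<theta>s by (intro AE_I2) (auto simp: prob_algebra_space_eq[OF \<mu>])
    qed
  qed
  from this[OF measurable_space[OF P_selector[OF \<phi>] Suc.prems]]
    this[OF measurable_space[OF P_selector[OF \<psi>] Suc.prems]]
  show ?case unfolding mixed_value.simps by (intro continuous_intros)
qed

text \<open>At the ends only one selector is played. The sign in the second part arises because
  \<open>\<psi>\<close> maximises \<open>- c\<close>, that is, minimises \<open>c\<close> among the
  optimal actions.\<close>

lemma mixed_value_0_1:
  assumes "\<And>k x. x \<in> space M \<Longrightarrow> (\<integral>y. lex_iter q u c k y \<partial>P (x, \<phi> k x)) = lex_iter q u c (Suc k) x"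
    and "\<And>k x. x \<in> space M \<Longrightarrow>
      (\<integral>y. lex_iter q u (\<lambda>x. - c x) k y \<partial>P (x, \<psi> k x)) = lex_iter q u (\<lambda>x. - c x) (Suc k) x"
    and "\<And>k. \<phi> k \<in> M \<rightarrow>\<^sub>M N" "\<And>k. \<psi> k \<in> M \<rightarrow>\<^sub>M N"
  shows "x \<in> space M \<Longrightarrow> mixed_value c \<phi> \<psi> 0 k x = lex_iter q u c k x"
    and "x \<in> space M \<Longrightarrow> mixed_value c \<phi> \<psi> 1 k x = - lex_iter q u (\<lambda>x. - c x) k x"
proof (induction k arbitrary: x)
  case (Suc k)
  have sp: "space (P (x, \<phi> k x)) = space M" "space (P (x, \<psi> k x)) = space M" if "x \<in> space M" for x
    using measurable_space[OF P_selector[OF assms(3)] that] measurable_space[OF P_selector[OF assms(4)] that]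
    by (auto simp: prob_algebra_space_eq)
  {
    case 1
    have "(\<integral>y. mixed_value c \<phi> \<psi> 0 k y \<partial>P (x, \<phi> k x)) = (\<integral>y. lex_iter q u c k y \<partial>P (x, \<phi> k x))"
      by (intro Bochner_Integration.integral_cong refl Suc.IH(1)) (simp only: sp(1)[OF 1])
    then show ?case using assms(1)[OF 1, of k] by (simp del: lex_iter.simps)
  next
    case 2
    have "(\<integral>y. mixed_value c \<phi> \<psi> 1 k y \<partial>P (x, \<psi> k x)) = (\<integral>y. - lex_iter q u (\<lambda>x. - c x) k y \<partial>P (x, \<psi> k x))"
      by (intro Bochner_Integration.integral_cong refl Suc.IH(2)) (simp only: sp(2)[OF 2])
    then show ?case using assms(2)[OF 2, of k] by (simp del: lex_iter.simps)
  }
qed simp_all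

section \<open>Weak and strong duality\<close>

context
  fixes H :: nat and r :: "nat \<Rightarrow> 's \<times> 'a \<Rightarrow> real" and r\<^sub>H c :: "'s \<Rightarrow> real" and s\<^sub>0 :: 's
  assumes r: "\<And>t. r t \<in> caratheodory" and r\<^sub>H: "r\<^sub>H \<in> bdd_measurable M" and c: "c \<in> bdd_measurable M"
    and s\<^sub>0: "s\<^sub>0 \<in> space M"
begin

text \<open>Time reversal: \<open>k\<close> stages remain after time \<open>H - Suc k\<close>. The
  multiplier goes into the terminal reward, so that the Lagrangian is again a problem of the same
  kind.\<close>

abbreviation "stage_reward k \<equiv> r (H - Suc k)"
abbreviation "lagrange_terminal \<beta> \<equiv> (\<lambda>x. r\<^sub>H x + \<beta> * c x)"
abbreviation "reward \<equiv> reward_value M N P H r r\<^sub>H s\<^sub>0"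
abbreviation "constraint \<equiv> terminal_value M N P H c s\<^sub>0"

lemma lagrange_terminal: "lagrange_terminal \<beta> \<in> bdd_measurable M"
  by (intro bdd_measurable_add bdd_measurable_cmult r\<^sub>H c)

lemma lagrangian_eq:
  assumes \<pi>: "\<pi> \<in> policies M N H"
  shows "reward \<pi> + \<beta> * constraint \<pi> =
    (\<integral>h. (\<Sum>i<H. r i (fst h i)) + lagrange_terminal \<beta> (snd h) \<partial>history_law M N P s\<^sub>0 \<pi> H)"
proof -
  note L = history_law_in_prob_algebra[OF P s\<^sub>0 \<pi> order_refl]
  note b = bdd_measurable_integrable[OF L bdd_measurable_history_value[OF caratheodoryD(1)[OF r] r\<^sub>H]]
  have "integrable (history_law M N P s\<^sub>0 \<pi> H) (\<lambda>h. c (snd h))"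
    using bdd_measurable_integrable[OF L bdd_measurable_history_value[where r = "\<lambda>_ _. 0", OF bdd_measurable_const c]]
    by simp
  then show ?thesis
    unfolding reward_value_def terminal_value_def
    using Bochner_Integration.integral_add[OF b integrable_mult_right[of \<beta>]]
    by (simp add: add.assoc)
qed

text \<open>Weak duality: each stage return is an average of action values, which are at most their
  supremum, so remembering the history gains nothing over the dynamic programming value.\<close>

lemma lagrangian_le:
  assumes \<pi>: "\<pi> \<in> policies M N H"
  shows "reward \<pi> + \<beta> * constraint \<pi> \<le> value_iter stage_reward (lagrange_terminal \<beta>) H s\<^sub>0"
proof -
  let ?V = "value_iter stage_reward (lagrange_terminal \<beta>)"
  note b = bdd_measurable_value_iter[where q = stage_reward, OF r lagrange_terminal[of \<beta>]]
  note stage = caratheodory_stage[where q = stage_reward, OF r lagrange_terminal[of \<beta>]]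
  have "(\<integral>h. (\<Sum>i<H. r i (fst h i)) + ?V (H - H) (snd h) \<partial>history_law M N P s\<^sub>0 \<pi> H) \<le> ?V (H - 0) s\<^sub>0"
  proof (rule history_value_le[OF P s\<^sub>0 \<pi> caratheodoryD(1)[OF r]])
    fix t h assume t: "t < H" and h: "h \<in> space (history_space M N t)"
    define k where "k = H - Suc t"
    have k: "H - t = Suc k" "H - Suc t = k" "t = H - Suc k" using t by (auto simp: k_def)
    have x: "snd h \<in> space M" using h by (auto simp: history_space_def space_pair_measure)
    note \<pi>h = policy_in_prob_algebra[OF \<pi> t h]
    have "(\<integral>a. r t (snd h, a) + (\<integral>s. ?V (H - Suc t) s \<partial>P (snd h, a)) \<partial>\<pi> t h) \<le> (\<integral>a. ?V (Suc k) (snd h) \<partial>\<pi> t h)"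
    proof (rule prob_algebra_integral_mono[OF \<pi>h _ bdd_measurable_const])
      show "(\<lambda>a. r t (snd h, a) + (\<integral>s. ?V (H - Suc t) s \<partial>P (snd h, a))) \<in> bdd_measurable N"
        using bdd_measurable_compose[OF caratheodoryD(1)[OF stage[of k]], of "Pair (snd h)" N] x k by simp
      show "r t (snd h, a) + (\<integral>s. ?V (H - Suc t) s \<partial>P (snd h, a)) \<le> ?V (Suc k) (snd h)" if "a \<in> space N" for a
        using SUP_upper_caratheodory[OF stage[of k] x, of a] that k by (simp add: space_restrict_space)
    qed
    then show "(\<integral>a. r t (snd h, a) + (\<integral>s. ?V (H - Suc t) s \<partial>P (snd h, a)) \<partial>\<pi> t h) \<le> ?V (H - t) (snd h)"
      unfolding k(1) prob_algebra_integral_const[OF \<pi>h] .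
  qed (rule b)
  then show ?thesis using lagrangian_eq[OF \<pi>] by simp
qed

text \<open>The Lagrange dual function: the best reward plus \<open>\<beta>\<close> times the slack
  of the constraint, computed by dynamic programming.\<close>

definition dual :: "real \<Rightarrow> real \<Rightarrow> real" where
  "dual \<delta> \<beta> = value_iter stage_reward (lagrange_terminal \<beta>) H s\<^sub>0 - \<beta> * \<delta>"

text \<open>As \<open>c\<close> lies in the unit interval, the value moves by at most the change of
  the multiplier; the linear term contributes the factor
  \<open>\<bar>\<delta>\<bar>\<close>.\<close>

lemma continuous_on_dual:
  assumes "\<And>x. x \<in> space M \<Longrightarrow> c x \<in> {0..1}"
  shows "continuous_on X (dual \<delta>)"
proof (rule lipschitz_on_continuous_on, rule lipschitz_onI)
  fix \<beta> \<mu> :: real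
  have le: "value_iter stage_reward (lagrange_terminal \<beta>) H s\<^sub>0 \<le>
      value_iter stage_reward (lagrange_terminal \<mu>) H s\<^sub>0 + \<bar>\<beta> - \<mu>\<bar>" for \<beta> \<mu>
  proof (rule value_iter_lipschitz[where q = stage_reward, OF r lagrange_terminal lagrange_terminal _ s\<^sub>0])
    fix x assume "x \<in> space M"
    then have "\<beta> * c x - \<mu> * c x \<le> \<bar>\<beta> - \<mu>\<bar> * 1"
      unfolding left_diff_distrib[symmetric] using assms[of x]
      by (intro order_trans[OF mult_right_mono[OF abs_ge_self] mult_left_mono]) auto
    then show "lagrange_terminal \<beta> x \<le> lagrange_terminal \<mu> x + \<bar>\<beta> - \<mu>\<bar>" by simp
  qed
  have "dist (dual \<delta> \<beta>) (dual \<delta> \<mu>) \<le> \<bar>\<beta> - \<mu>\<bar> + \<bar>\<beta> * \<delta> - \<mu> * \<delta>\<bar>"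
    using le[of \<beta> \<mu>] le[of \<mu> \<beta>] unfolding dual_def dist_real_def by linarith
  also have "\<bar>\<beta> * \<delta> - \<mu> * \<delta>\<bar> = \<bar>\<beta> - \<mu>\<bar> * \<bar>\<delta>\<bar>" by (simp add: left_diff_distrib[symmetric] abs_mult)
  finally show "dist (dual \<delta> \<beta>) (dual \<delta> \<mu>) \<le> (1 + \<bar>\<delta>\<bar>) * dist \<beta> \<mu>"
    by (simp add: dist_real_def algebra_simps)
qed simp

text \<open>The strictly feasible policy bounds the dual function from below by a line of slope
  \<open>\<nu>\<close>, so a minimiser is found in a compact interval.\<close>

lemma dual_attains_min:
  assumes c01: "\<And>x. x \<in> space M \<Longrightarrow> c x \<in> {0..1}"
    and \<pi>\<^sub>0: "\<pi>\<^sub>0 \<in> policies M N H" "0 < \<nu>" "\<delta> + \<nu> \<le> constraint \<pi>\<^sub>0"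
  obtains \<beta> where "0 \<le> \<beta>" "\<And>\<mu>. 0 \<le> \<mu> \<Longrightarrow> dual \<delta> \<beta> \<le> dual \<delta> \<mu>"
proof -
  have ge: "reward \<pi>\<^sub>0 + \<mu> * \<nu> \<le> dual \<delta> \<mu>" if "0 \<le> \<mu>" for \<mu>
  proof -
    have "\<mu> * \<nu> \<le> \<mu> * (constraint \<pi>\<^sub>0 - \<delta>)" using that \<pi>\<^sub>0(3) by (intro mult_left_mono) auto
    then show ?thesis using lagrangian_le[OF \<pi>\<^sub>0(1), of \<mu>] by (simp add: dual_def right_diff_distrib)
  qed
  \<comment> \<open>The point where the lower line reaches the level \<open>dual \<delta> 0\<close>;
    beyond it the dual function cannot fall below its value at 0.\<close>
  define L where "L = (dual \<delta> 0 - reward \<pi>\<^sub>0) / \<nu>"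
  have L: "0 \<le> L" using ge[of 0] \<pi>\<^sub>0(2) by (simp add: L_def)
  then have "{0..L} \<noteq> {}" by simp
  from continuous_attains_inf[OF compact_Icc this continuous_on_dual[OF c01]]
  obtain \<beta> where \<beta>: "\<beta> \<in> {0..L}" "\<forall>\<mu>\<in>{0..L}. dual \<delta> \<beta> \<le> dual \<delta> \<mu>" by blast
  show ?thesis
  proof (rule that)
    show "0 \<le> \<beta>" using \<beta> by simp
    fix \<mu> :: real assume \<mu>: "0 \<le> \<mu>"
    show "dual \<delta> \<beta> \<le> dual \<delta> \<mu>"
    proof (cases "\<mu> \<le> L")
      case True
      then show ?thesis using \<beta> \<mu> by simp
    next
      case False
      have "dual \<delta> \<beta> \<le> dual \<delta> 0" using \<beta> L by simp
      also have "\<dots> = reward \<pi>\<^sub>0 + L * \<nu>" using \<pi>\<^sub>0(2) by (simp add: L_def)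
      also have "\<dots> \<le> reward \<pi>\<^sub>0 + \<mu> * \<nu>" using False \<pi>\<^sub>0(2) by simp
      also have "\<dots> \<le> dual \<delta> \<mu>" by (rule ge[OF \<mu>])
      finally show ?thesis .
    qed
  qed
qed

lemma markov_policy_of_kernel:
  assumes "\<And>t. \<kappa> t \<in> M \<rightarrow>\<^sub>M prob_algebra N"
  shows "(\<lambda>t h. \<kappa> t (snd h)) \<in> markov_policies M N H"
  unfolding markov_policies_def policies_def history_space_def
  using assms by (auto intro: measurable_compose[OF measurable_snd])

lemma exists_markov_constrained_optimal:
  assumes c01: "\<And>x. x \<in> space M \<Longrightarrow> c x \<in> {0..1}"
    and slater: "\<pi>\<^sub>0 \<in> policies M N H" "0 < \<nu>" "\<delta> + \<nu> \<le> constraint \<pi>\<^sub>0"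
  shows "\<exists>\<sigma>\<in>markov_policies M N H. constrained_optimal (policies M N H) reward constraint \<delta> \<sigma>"
proof -
  obtain \<beta> where \<beta>: "0 \<le> \<beta>" and min: "\<And>\<mu>. 0 \<le> \<mu> \<Longrightarrow> dual \<delta> \<beta> \<le> dual \<delta> \<mu>"
    using dual_attains_min[OF c01 slater] by blast
  let ?u = "lagrange_terminal \<beta>"
  let ?V = "value_iter stage_reward ?u"
  have c': "(\<lambda>x. - c x) \<in> bdd_measurable M" by (rule bdd_measurable_uminus[OF c])
  note u = lagrange_terminal[of \<beta>]
  obtain \<phi> where \<phi>: "\<And>k. \<phi> k \<in> M \<rightarrow>\<^sub>M N" "\<And>k x. x \<in> space M \<Longrightarrow> gap stage_reward ?u k (x, \<phi> k x) = 0"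
    "\<And>k x. x \<in> space M \<Longrightarrow> (\<integral>y. lex_iter stage_reward ?u c k y \<partial>P (x, \<phi> k x)) = lex_iter stage_reward ?u c (Suc k) x"
    by (rule lex_selectors[where q = stage_reward, OF r u c]) (rule that, blast+)
  obtain \<psi> where \<psi>: "\<And>k. \<psi> k \<in> M \<rightarrow>\<^sub>M N" "\<And>k x. x \<in> space M \<Longrightarrow> gap stage_reward ?u k (x, \<psi> k x) = 0"
    "\<And>k x. x \<in> space M \<Longrightarrow> (\<integral>y. lex_iter stage_reward ?u (\<lambda>x. - c x) k y \<partial>P (x, \<psi> k x)) =
      lex_iter stage_reward ?u (\<lambda>x. - c x) (Suc k) x"
    by (rule lex_selectors[where q = stage_reward, OF r u c']) (rule that, blast+)
  let ?C = "\<lambda>\<theta>. mixed_value c \<phi> \<psi> \<theta> H s\<^sub>0"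
  have mix0: "?C 0 = lex_iter stage_reward ?u c H s\<^sub>0"
    by (rule mixed_value_0_1(1)[where q = stage_reward, OF \<phi>(3) \<psi>(3) \<phi>(1) \<psi>(1) s\<^sub>0])
  have mix1: "?C 1 = - lex_iter stage_reward ?u (\<lambda>x. - c x) H s\<^sub>0"
    by (rule mixed_value_0_1(2)[where q = stage_reward, OF \<phi>(3) \<psi>(3) \<phi>(1) \<psi>(1) s\<^sub>0])
  \<comment> \<open>Minimality of \<open>\<beta>\<close> against
    \<open>\<beta> + 1 / real (Suc n)\<close>: the optimal value grows by at least
    \<open>\<delta>\<close> times the step, so the right derivative is at least
    \<open>\<delta>\<close>.\<close>
  have C0: "\<delta> \<le> ?C 0"
    unfolding mix0
  proof (rule lex_iter_ge[where q = stage_reward, OF r u c s\<^sub>0], intro always_eventually allI)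
    fix n
    have "(\<lambda>x. ?u x + c x / real (Suc n)) = lagrange_terminal (\<beta> + 1 / real (Suc n))"
      by (simp add: distrib_right add.assoc del: of_nat_Suc)
    then show "?V H s\<^sub>0 + \<delta> / real (Suc n) \<le> value_iter stage_reward (\<lambda>x. ?u x + c x / real (Suc n)) H s\<^sub>0"
      using min[of "\<beta> + 1 / real (Suc n)"] \<beta> by (simp add: dual_def distrib_right del: of_nat_Suc)
  qed
  have C1: "?C 1 \<le> \<delta>" if pos: "0 < \<beta>"
  proof -
    have "- \<delta> \<le> lex_iter stage_reward ?u (\<lambda>x. - c x) H s\<^sub>0"
    proof (rule lex_iter_ge[where q = stage_reward, OF r u c' s\<^sub>0])
      \<comment> \<open>Minimality is known only against nonnegative multipliers, so the step to the
        left must stay below \<open>\<beta>\<close>; this holds for all late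
        \<open>n\<close>.\<close>
      have "\<forall>\<^sub>F n in sequentially. inverse (real (Suc n)) < \<beta>"
        using order_tendstoD(2)[OF LIMSEQ_inverse_real_of_nat pos] .
      then show "\<forall>\<^sub>F n in sequentially. ?V H s\<^sub>0 + - \<delta> / real (Suc n) \<le>
          value_iter stage_reward (\<lambda>x. ?u x + - c x / real (Suc n)) H s\<^sub>0"
      proof eventually_elim
        case (elim n)
        have "(\<lambda>x. ?u x + - c x / real (Suc n)) = lagrange_terminal (\<beta> - 1 / real (Suc n))"
          by (simp add: left_diff_distrib add_diff_eq del: of_nat_Suc)
        then show ?case
          using min[of "\<beta> - 1 / real (Suc n)"] elim
          by (simp add: dual_def left_diff_distrib inverse_eq_divide del: of_nat_Suc)
      qed
    qed
    then show ?thesis unfolding mix1 by simp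
  qed
  \<comment> \<open>Complementary slackness. With a zero multiplier the end
    \<open>\<theta> = 0\<close> already serves; otherwise \<open>?C\<close> passes continuously from
    at least \<open>\<delta>\<close> to at most \<open>\<delta>\<close>.\<close>
  have "\<exists>\<theta>\<in>{0..1}. \<delta> \<le> ?C \<theta> \<and> \<beta> * (?C \<theta> - \<delta>) = 0"
  proof (cases "\<beta> = 0")
    case True
    then show ?thesis using C0 by (intro bexI[of _ 0]) auto
  next
    case False
    have "continuous_on {0..1} ?C"
      by (rule continuous_on_mixed_value[OF bdd_measurableD[OF c] c01 \<phi>(1) \<psi>(1) s\<^sub>0])
    from IVT2'[OF _ C0 _ this] False C1 \<beta> obtain \<theta> where "0 \<le> \<theta>" "\<theta> \<le> 1" "?C \<theta> = \<delta>" by auto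
    then show ?thesis by (intro bexI[of _ \<theta>]) auto
  qed
  then obtain \<theta> where \<theta>: "\<theta> \<in> {0..1}" "\<delta> \<le> ?C \<theta>" "\<beta> * (?C \<theta> - \<delta>) = 0" by blast
  \<comment> \<open>The selectors are indexed by stages remaining, so time \<open>t\<close> uses
    index \<open>H - Suc t\<close>. Only \<open>snd h\<close> is read, which makes the policy
    Markov.\<close>
  define \<sigma> :: "('s, 'a) policy" where
    "\<sigma> t h = mixed_kernel N \<theta> (\<phi> (H - Suc t)) (\<psi> (H - Suc t)) (snd h)" for t h
  have markov: "\<sigma> \<in> markov_policies M N H"
    unfolding \<sigma>_def[abs_def] by (intro markov_policy_of_kernel measurable_mixed_kernel \<phi>(1) \<psi>(1))
  then have \<sigma>: "\<sigma> \<in> policies M N H" by (simp add: markov_policies_def)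
  have int_\<sigma>: "(\<integral>a. f (snd h, a) \<partial>\<sigma> t h) =
      (1 - \<theta>) * f (snd h, \<phi> (H - Suc t) (snd h)) + \<theta> * f (snd h, \<psi> (H - Suc t) (snd h))"
    if h: "h \<in> space (history_space M N t)" and f: "f \<in> bdd_measurable (M \<Otimes>\<^sub>M N)" for t h and f :: "'s \<times> 'a \<Rightarrow> real"
  proof -
    have x: "snd h \<in> space M" using h by (auto simp: history_space_def space_pair_measure)
    show ?thesis
      unfolding \<sigma>_def using \<theta>(1) measurable_space[OF \<phi>(1) x] measurable_space[OF \<psi>(1) x]
        measurable_compose[OF measurable_Pair1'[OF x] bdd_measurableD[OF f]]
      by (intro integral_mixed_kernel) auto
  qed
  \<comment> \<open>Both selectors have zero gap at every state, so any mixture of them satisfies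
    the Bellman equation with equality.\<close>
  have sum: "reward \<sigma> + \<beta> * constraint \<sigma> = ?V H s\<^sub>0"
  proof -
    note b = bdd_measurable_value_iter[where q = stage_reward, OF r u]
    have "(\<integral>h. (\<Sum>i<H. r i (fst h i)) + ?V (H - H) (snd h) \<partial>history_law M N P s\<^sub>0 \<sigma> H) = ?V (H - 0) s\<^sub>0"
    proof (rule history_value_eq[OF P s\<^sub>0 \<sigma> caratheodoryD(1)[OF r]])
      fix t h assume t: "t < H" and h: "h \<in> space (history_space M N t)"
      define k where "k = H - Suc t"
      have k: "H - t = Suc k" "H - Suc t = k" "H - Suc k = t" using t by (auto simp: k_def)
      have x: "snd h \<in> space M" using h by (auto simp: history_space_def space_pair_measure)
      have "(\<integral>a. r t (snd h, a) + (\<integral>s. ?V k s \<partial>P (snd h, a)) \<partial>\<sigma> t h) =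
          (1 - \<theta>) * ?V (Suc k) (snd h) + \<theta> * ?V (Suc k) (snd h)"
        using int_\<sigma>[OF h caratheodoryD(1)[OF caratheodory_stage[where q = stage_reward, OF r u, of k]]]
          \<phi>(2)[OF x, of k] \<psi>(2)[OF x, of k] k
        by (simp add: gap_def del: value_iter.simps)
      then show "(\<integral>a. r t (snd h, a) + (\<integral>s. ?V (H - Suc t) s \<partial>P (snd h, a)) \<partial>\<sigma> t h) = ?V (H - t) (snd h)"
        unfolding k by (simp add: algebra_simps del: value_iter.simps)
    qed (rule b)
    then show ?thesis using lagrangian_eq[OF \<sigma>] by simp
  qed
  \<comment> \<open>The same evaluation with zero stage rewards and \<open>mixed_value\<close> as
    the sequence of value functions.\<close>
  have con: "constraint \<sigma> = ?C \<theta>"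
  proof -
    let ?W = "mixed_value c \<phi> \<psi> \<theta>"
    note b = mixed_value_bounds[where c = c and \<phi> = \<phi> and \<psi> = \<psi>, OF bdd_measurableD[OF c] c01 \<phi>(1) \<psi>(1) \<theta>(1), THEN conjunct1]
    have "(\<integral>h. (\<Sum>i<H. 0) + ?W (H - H) (snd h) \<partial>history_law M N P s\<^sub>0 \<sigma> H) = ?W (H - 0) s\<^sub>0"
    proof (rule history_value_eq[where r = "\<lambda>_ _. 0" and v = "\<lambda>t. ?W (H - t)", OF P s\<^sub>0 \<sigma> bdd_measurable_const b])
      fix t h assume t: "t < H" and h: "h \<in> space (history_space M N t)"
      define k where "k = H - Suc t"
      have k: "H - t = Suc k" "H - Suc t = k" using t by (auto simp: k_def)
      show "(\<integral>a. 0 + (\<integral>s. ?W (H - Suc t) s \<partial>P (snd h, a)) \<partial>\<sigma> t h) = ?W (H - t) (snd h)"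
        using int_\<sigma>[OF h bdd_measurable_integral_kernel[OF b[of k] P]] unfolding k by simp
    qed
    then show ?thesis unfolding terminal_value_def by simp
  qed
  \<comment> \<open>Weak duality for \<open>\<pi>\<close>, its nonnegative slack, and the vanishing
    slack term of \<open>\<sigma>\<close> combine.\<close>
  have "reward \<pi> \<le> reward \<sigma>" if \<pi>: "\<pi> \<in> policies M N H" "\<delta> \<le> constraint \<pi>" for \<pi>
  proof -
    have "0 \<le> \<beta> * (constraint \<pi> - \<delta>)" using \<beta> \<pi>(2) by simp
    then show ?thesis
      using lagrangian_le[OF \<pi>(1), of \<beta>] sum \<theta>(3) unfolding con right_diff_distrib by linarith
  qed
  then have "(SUP \<pi>\<in>{\<pi> \<in> policies M N H. \<delta> \<le> constraint \<pi>}. reward \<pi>) = reward \<sigma>"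
    using \<sigma> \<theta>(2) con by (intro cSup_eq_maximum) auto
  then show ?thesis
    using markov \<sigma> \<theta>(2) con unfolding constrained_optimal_def by (intro bexI[of _ \<sigma>]) auto
qed

end

end

section \<open>The augmented process\<close>

lemma flag_in: "flag K G x t \<in> {0, 1, 2}"
  by (cases t) (auto simp: flag_init_def flag_step_def indicator_def)

lemma flag_cong: "(\<And>i. i \<le> t \<Longrightarrow> x i = y i) \<Longrightarrow> flag K G x t = flag K G y t"
  by (induction t) auto

lemma flag_eq_1_iff: "flag K G x t = 1 \<longleftrightarrow> (\<forall>i\<le>t. x i \<in> K - G)"
proof (induction t)
  case 0
  show ?case by (auto simp: flag_init_def indicator_def)
next
  case (Suc t)
  then show ?case by (auto simp: flag_step_def le_Suc_eq)
qed

text \<open>Flag 2 is absorbing and, after time 0, is entered only from flag 1, which certifies a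
  path inside \<open>K - G\<close> so far. Read at the horizon, the flag thus decides the
  reach-avoid event.\<close>

lemma flag_eq_2_iff: "flag K G x t = 2 \<longleftrightarrow> (\<exists>i\<le>t. x i \<in> G \<and> (\<forall>j<i. x j \<in> K - G))"
proof (induction t)
  case 0
  show ?case by (auto simp: flag_init_def indicator_def)
next
  case (Suc t)
  have "flag K G x (Suc t) = 2 \<longleftrightarrow> flag K G x t = 2 \<or> (flag K G x t = 1 \<and> x (Suc t) \<in> G)"
    by (simp add: flag_step_def)
  then show ?case
    unfolding Suc flag_eq_1_iff by (simp add: le_Suc_eq less_Suc_eq_le ex_disj_distrib conj_disj_distribR) blast
qed

text \<open>The restriction leaves the entries from \<open>t\<close> on undefined, as the
  extensional product space demands. The flags are computed from the states, so only histories with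
  consistent flags are produced.\<close>

definition augment :: "'s set \<Rightarrow> 's set \<Rightarrow> nat \<Rightarrow> ('s, 'a) history \<Rightarrow> ('s \<times> nat, 'a) history" where
  "augment K G t h =
     ((\<lambda>i\<in>{..<t}. ((fst (fst h i), flag K G (state_at t h) i), snd (fst h i))),
      (snd h, flag K G (state_at t h) t))"

text \<open>A left inverse of \<open>augment\<close> only: augmented histories whose flags do not
  follow the update rule are not recovered.\<close>

definition strip :: "nat \<Rightarrow> ('s \<times> nat, 'a) history \<Rightarrow> ('s, 'a) history" where
  "strip t h = ((\<lambda>i\<in>{..<t}. (fst (fst (fst h i)), snd (fst h i))), fst (snd h))"

lemma strip_augment: "h \<in> space (history_space M N t) \<Longrightarrow> strip t (augment K G t h) = h"
  by (cases h) (auto simp: strip_def augment_def history_space_def space_pair_measure space_PiM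
      PiE_def extensional_def restrict_def fun_eq_iff)

text \<open>The intertwining relation behind the transfer of laws: a step of the original process
  followed by recording the flags is a step of the augmented one. Earlier flags do not change
  because they depend on earlier states only.\<close>

lemma augment_extend_history:
  "augment K G (Suc t) (extend_history t h a s) =
    extend_history t (augment K G t h) a (s, flag_step K G s (flag K G (state_at t h) t))"
proof -
  have st: "state_at (Suc t) (extend_history t h a s) i = state_at t h i" if "i \<le> t" for i
    using that by (auto simp: state_at_def extend_history_def)
  have fl: "flag K G (state_at (Suc t) (extend_history t h a s)) i = flag K G (state_at t h) i" if "i \<le> t" for i
    by (rule flag_cong) (use st that in auto)
  have "state_at (Suc t) (extend_history t h a s) (Suc t) = s"
    by (simp add: state_at_def extend_history_def)
  then show ?thesis
    using fl by (auto simp: augment_def extend_history_def restrict_def fun_eq_iff less_Suc_eq)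
qed

section \<open>Measurability of the flag bookkeeping\<close>

lemma measurable_flag_step:
  assumes [measurable]: "K \<in> sets M" "G \<in> sets M" "s \<in> L \<rightarrow>\<^sub>M M" "y \<in> L \<rightarrow>\<^sub>M count_space {0, 1, 2}"
  shows "(\<lambda>x. flag_step K G (s x) (y x)) \<in> L \<rightarrow>\<^sub>M count_space {0, 1, 2}"
proof -
  have [measurable]: "Measurable.pred L (\<lambda>x. y x = j)" for j
    by (rule measurable_compose[OF assms(4)]) simp
  show ?thesis unfolding flag_step_def by measurable
qed

lemma measurable_state_at: "(\<lambda>h. state_at t h i) \<in> history_space M N t \<rightarrow>\<^sub>M M"
  unfolding state_at_def history_space_def by (cases "i < t") (simp_all, measurable)

lemma measurable_flag:
  assumes K: "K \<in> sets M" and G: "G \<in> sets M"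
  shows "(\<lambda>h. flag K G (state_at t h) i) \<in> history_space M N t \<rightarrow>\<^sub>M count_space {0, 1, 2}"
proof (induction i)
  case 0
  have [measurable]: "(\<lambda>h. state_at t h 0) \<in> history_space M N t \<rightarrow>\<^sub>M M" by (rule measurable_state_at)
  have "(\<lambda>h. if state_at t h 0 \<in> G then 2 else if state_at t h 0 \<in> K then 1 else (0::nat))
      \<in> history_space M N t \<rightarrow>\<^sub>M count_space {0, 1, 2}"
    using K G by measurable
  moreover have "flag K G x 0 = (if x 0 \<in> G then 2 else if x 0 \<in> K then 1 else 0)" for x
    by (simp add: flag_init_def indicator_def)
  ultimately show ?case by simp
next
  case (Suc i)
  then show ?case using measurable_flag_step[OF K G measurable_state_at] by simp
qed

lemma measurable_augment:
  assumes "K \<in> sets M" "G \<in> sets M"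
  shows "augment K G t \<in> history_space M N t \<rightarrow>\<^sub>M history_space (aug_space M) N t"
proof -
  have [measurable]: "(\<lambda>h. flag K G (state_at t h) i) \<in> history_space M N t \<rightarrow>\<^sub>M count_space {0, 1, 2}" for i
    by (rule measurable_flag[OF assms])
  have [measurable]: "(\<lambda>h. fst h i) \<in> history_space M N t \<rightarrow>\<^sub>M M \<Otimes>\<^sub>M N" if "i < t" for i
    using that unfolding history_space_def by (simp, measurable)
  have [measurable]: "snd \<in> history_space M N t \<rightarrow>\<^sub>M M" unfolding history_space_def by measurable
  show ?thesis
    unfolding augment_def[abs_def] aug_space_def history_space_def[of "M \<Otimes>\<^sub>M count_space {0, 1, 2}"]
    by (intro measurable_Pair measurable_restrict) (auto simp del: One_nat_def)
qed

lemma measurable_strip: "strip t \<in> history_space (aug_space M) N t \<rightarrow>\<^sub>M history_space M N t"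
proof -
  have [measurable]: "(\<lambda>h. fst h i) \<in> history_space (aug_space M) N t \<rightarrow>\<^sub>M (M \<Otimes>\<^sub>M count_space {0, 1, 2}) \<Otimes>\<^sub>M N"
    if "i < t" for i
    using that unfolding history_space_def aug_space_def by (simp, measurable)
  have [measurable]: "snd \<in> history_space (aug_space M) N t \<rightarrow>\<^sub>M M \<Otimes>\<^sub>M count_space {0, 1, 2}"
    unfolding history_space_def aug_space_def by measurable
  show ?thesis
    unfolding strip_def[abs_def] history_space_def[of M]
    by (intro measurable_Pair measurable_restrict) (auto simp del: One_nat_def)
qed

lemma measurable_aug_transition:
  assumes "K \<in> sets M" "G \<in> sets M" "y \<in> {0, 1, 2}"
  shows "(\<lambda>s. (s, flag_step K G s y)) \<in> M \<rightarrow>\<^sub>M aug_space M"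
  unfolding aug_space_def
  by (intro measurable_Pair measurable_flag_step assms measurable_ident measurable_const) (use assms in auto)

lemma measurable_aug_kernel:
  assumes P: "P \<in> M \<Otimes>\<^sub>M N \<rightarrow>\<^sub>M prob_algebra M" and K: "K \<in> sets M" and G: "G \<in> sets M"
  shows "aug_kernel M P K G \<in> aug_space M \<Otimes>\<^sub>M N \<rightarrow>\<^sub>M prob_algebra (aug_space M)"
proof -
  have "(\<lambda>z. (fst (fst z), snd z)) \<in> aug_space M \<Otimes>\<^sub>M N \<rightarrow>\<^sub>M M \<Otimes>\<^sub>M N"
    unfolding aug_space_def by measurable
  from measurable_compose[OF this P]
  have "(\<lambda>z. P (fst (fst z), snd z)) \<in> aug_space M \<Otimes>\<^sub>M N \<rightarrow>\<^sub>M prob_algebra M" .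
  moreover have "(\<lambda>(z, s). (s, flag_step K G s (snd (fst z)))) \<in> (aug_space M \<Otimes>\<^sub>M N) \<Otimes>\<^sub>M M \<rightarrow>\<^sub>M aug_space M"
    unfolding aug_space_def case_prod_beta'
    by (intro measurable_Pair measurable_flag_step[OF K G]) measurable
  ultimately show ?thesis
    using measurable_distr_prob_space2[of "\<lambda>z. P (fst (fst z), snd z)" "aug_space M \<Otimes>\<^sub>M N" M
        "\<lambda>z s. (s, flag_step K G s (snd (fst z)))" "aug_space M"]
    unfolding aug_kernel_def case_prod_beta' by blast
qed

section \<open>Transfer of laws and values\<close>

lemma space_history_spaceD: "h \<in> space (history_space M N t) \<Longrightarrow> snd h \<in> space M"
  by (auto simp: history_space_def space_pair_measure)

text \<open>Pushforward commutes with both binds, and the augmented kernel is by construction the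
  pushforward of \<open>P\<close> that appends the new flag. Agreement of the policies along
  \<open>augment\<close> suffices because inconsistent histories are never visited; so one lemma
  serves both for policies that ignore the flags and for \<open>deaugment\<close>.\<close>

lemma distr_history_law_augment:
  assumes P: "P \<in> M \<Otimes>\<^sub>M N \<rightarrow>\<^sub>M prob_algebra M" and s\<^sub>0: "s\<^sub>0 \<in> space M"
    and K: "K \<in> sets M" and G: "G \<in> sets M"
    and \<pi>: "\<pi> \<in> policies M N H" and \<pi>': "\<pi>' \<in> policies (aug_space M) N H"
    and eq: "\<And>t h. t < H \<Longrightarrow> h \<in> space (history_space M N t) \<Longrightarrow> \<pi>' t (augment K G t h) = \<pi> t h"
  shows "t \<le> H \<Longrightarrow> distr (history_law M N P s\<^sub>0 \<pi> t) (history_space (aug_space M) N t) (augment K G t) =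
    history_law (aug_space M) N (aug_kernel M P K G) (aug_init K G s\<^sub>0) \<pi>' t"
proof (induction t)
  case 0
  have "(\<lambda>_. undefined, s\<^sub>0) \<in> space (history_space M N 0)"
    using s\<^sub>0 by (simp add: history_space_def space_pair_measure space_PiM)
  moreover have "augment K G 0 (\<lambda>_. undefined :: 'a \<times> 'b, s\<^sub>0) = (\<lambda>_. undefined, aug_init K G s\<^sub>0)"
    by (simp add: augment_def aug_init_def state_at_def restrict_def)
  ultimately show ?case
    using distr_return[OF measurable_augment[OF K G, of 0 N]] by simp
next
  case (Suc t)
  then have t: "t < H" by simp
  let ?L = "history_law M N P s\<^sub>0 \<pi> t" and ?S = "history_space (aug_space M) N"
  let ?P = "aug_kernel M P K G"
  note P' = measurable_aug_kernel[OF P K G]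
  note aug = measurable_augment[OF K G, of _ N]
  have L: "?L \<in> space (prob_algebra (history_space M N t))"
    using history_law_in_prob_algebra[OF P s\<^sub>0 \<pi>] t by simp
  have ne: "space ?L \<noteq> {}" using L by (auto simp: space_prob_algebra dest: prob_space.not_empty)
  have "distr (history_law M N P s\<^sub>0 \<pi> (Suc t)) (?S (Suc t)) (augment K G (Suc t)) =
      bind ?L (\<lambda>h. distr (bind (\<pi> t h) (step_kernel M N P t h)) (?S (Suc t)) (augment K G (Suc t)))"
    unfolding history_law_Suc
    by (rule distr_bind[OF _ ne aug])
      (use measurable_prob_algebraD[OF measurable_policy_step[OF P \<pi> t]] prob_algebra_measurable_eq[OF L] in auto)
  also have "\<dots> = bind ?L (\<lambda>h. bind (\<pi>' t (augment K G t h)) (step_kernel (aug_space M) N ?P t (augment K G t h)))"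
  proof (rule bind_cong[OF refl])
    fix h assume "h \<in> space ?L"
    then have h: "h \<in> space (history_space M N t)" by (simp add: prob_algebra_space_eq[OF L])
    note x = space_history_spaceD[OF h]
    note \<pi>h = policy_in_prob_algebra[OF \<pi> t h]
    have "step_kernel M N P t h \<in> N \<rightarrow>\<^sub>M prob_algebra (history_space M N (Suc t))"
      using measurable_compose[OF measurable_Pair1'[OF h] measurable_step_kernel[OF P]] by simp
    then have "distr (bind (\<pi> t h) (step_kernel M N P t h)) (?S (Suc t)) (augment K G (Suc t)) =
        bind (\<pi> t h) (\<lambda>a. distr (step_kernel M N P t h a) (?S (Suc t)) (augment K G (Suc t)))"
      using \<pi>h by (intro distr_bind[OF _ _ aug])
        (auto simp: prob_algebra_measurable_eq[OF \<pi>h] space_prob_algebra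
          dest: measurable_prob_algebraD prob_space.not_empty)
    also have "\<dots> = bind (\<pi> t h) (step_kernel (aug_space M) N ?P t (augment K G t h))"
    proof (rule bind_cong[OF refl])
      fix a assume "a \<in> space (\<pi> t h)"
      then have a: "a \<in> space N" by (simp add: prob_algebra_space_eq[OF \<pi>h])
      let ?y = "flag K G (state_at t h) t"
      have Pa: "P (snd h, a) \<in> space (prob_algebra M)"
        using measurable_space[OF P] a x by (auto simp: space_pair_measure)
      have ext: "extend_history t h a \<in> M \<rightarrow>\<^sub>M history_space M N (Suc t)"
        using measurable_compose[OF measurable_Pair1' measurable_extend_history, of "(h, a)"] h a
        by (simp add: space_pair_measure)
      have ext': "extend_history t (augment K G t h) a \<in> aug_space M \<rightarrow>\<^sub>M ?S (Suc t)"
        using measurable_compose[OF measurable_Pair1' measurable_extend_history, of "(augment K G t h, a)"]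
          measurable_space[OF aug h] a
        by (simp add: space_pair_measure)
      have "distr (step_kernel M N P t h a) (?S (Suc t)) (augment K G (Suc t)) =
          distr (P (snd h, a)) (?S (Suc t)) (augment K G (Suc t) \<circ> extend_history t h a)"
        unfolding step_kernel_def
        by (rule distr_distr[OF aug]) (use ext in \<open>simp add: prob_algebra_measurable_eq[OF Pa]\<close>)
      also have "augment K G (Suc t) \<circ> extend_history t h a =
          extend_history t (augment K G t h) a \<circ> (\<lambda>s. (s, flag_step K G s ?y))"
        by (simp add: fun_eq_iff augment_extend_history)
      also have "distr (P (snd h, a)) (?S (Suc t)) \<dots> =
          distr (distr (P (snd h, a)) (aug_space M) (\<lambda>s. (s, flag_step K G s ?y))) (?S (Suc t))
            (extend_history t (augment K G t h) a)"
        by (rule distr_distr[symmetric, OF ext'])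
          (use measurable_aug_transition[OF K G flag_in] in \<open>simp add: prob_algebra_measurable_eq[OF Pa]\<close>)
      also have "\<dots> = step_kernel (aug_space M) N ?P t (augment K G t h) a"
        by (simp add: step_kernel_def aug_kernel_def augment_def)
      finally show "distr (step_kernel M N P t h a) (?S (Suc t)) (augment K G (Suc t)) =
        step_kernel (aug_space M) N ?P t (augment K G t h) a" .
    qed
    finally show "distr (bind (\<pi> t h) (step_kernel M N P t h)) (?S (Suc t)) (augment K G (Suc t)) =
        bind (\<pi>' t (augment K G t h)) (step_kernel (aug_space M) N ?P t (augment K G t h))"
      by (simp add: eq[OF t h])
  qed
  \<comment> \<open>The inner term depends on \<open>h\<close> only through
    \<open>augment K G t h\<close>, so the bind can be taken over the pushforward law, to which the
    induction hypothesis applies.\<close>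
  also have "\<dots> = bind (distr ?L (?S t) (augment K G t)) (\<lambda>h. bind (\<pi>' t h) (step_kernel (aug_space M) N ?P t h))"
    by (rule bind_distr[symmetric, OF _ measurable_prob_algebraD[OF measurable_policy_step[OF P' \<pi>' t]] ne])
      (use aug in \<open>simp add: prob_algebra_measurable_eq[OF L]\<close>)
  also have "\<dots> = history_law (aug_space M) N ?P (aug_init K G s\<^sub>0) \<pi>' (Suc t)"
    unfolding history_law_Suc using Suc by simp
  finally show ?case .
qed

lemma bdd_measurable_aug_reward:
  "r t \<in> bdd_measurable (M \<Otimes>\<^sub>M N) \<Longrightarrow> aug_reward r t \<in> bdd_measurable (aug_space M \<Otimes>\<^sub>M N)"
  unfolding aug_reward_def case_prod_beta' aug_space_def
  by (rule bdd_measurable_compose[of _ "M \<Otimes>\<^sub>M N"]) measurable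

lemma bdd_measurable_aug_terminal_reward:
  "r\<^sub>H \<in> bdd_measurable M \<Longrightarrow> aug_terminal_reward r\<^sub>H \<in> bdd_measurable (aug_space M)"
  unfolding aug_terminal_reward_def case_prod_beta' aug_space_def
  by (rule bdd_measurable_compose[of _ M]) measurable

lemma bdd_measurable_aug_constraint: "aug_constraint \<in> bdd_measurable (aug_space M)"
proof (rule bdd_measurableI)
  have "(\<lambda>y. if y = 2 then 1 else 0 :: real) \<in> borel_measurable (count_space {0, 1, 2 :: nat})" by simp
  from measurable_compose[OF measurable_snd this, of M]
  show "aug_constraint \<in> borel_measurable (aug_space M)"
    by (simp add: aug_constraint_def aug_space_def case_prod_beta')
  show "\<bar>aug_constraint x\<bar> \<le> 1" for x :: "'a \<times> nat"
    by (simp add: aug_constraint_def case_prod_beta')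
qed

context
  fixes M :: "'s measure" and N :: "'a measure" and P and s\<^sub>0 and K G :: "'s set" and \<pi> \<pi>' and H :: nat
  assumes P: "P \<in> M \<Otimes>\<^sub>M N \<rightarrow>\<^sub>M prob_algebra M" and s\<^sub>0: "s\<^sub>0 \<in> space M"
    and K: "K \<in> sets M" and G: "G \<in> sets M"
    and \<pi>: "\<pi> \<in> policies M N H" and \<pi>': "\<pi>' \<in> policies (aug_space M) N H"
    and eq: "\<And>t h. t < H \<Longrightarrow> h \<in> space (history_space M N t) \<Longrightarrow> \<pi>' t (augment K G t h) = \<pi> t h"
begin

lemma integral_history_law_augment:
  assumes "f \<in> borel_measurable (history_space (aug_space M) N H)"
  shows "(\<integral>h. (f h :: real) \<partial>history_law (aug_space M) N (aug_kernel M P K G) (aug_init K G s\<^sub>0) \<pi>' H) =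
    (\<integral>h. f (augment K G H h) \<partial>history_law M N P s\<^sub>0 \<pi> H)"
proof -
  have "history_law (aug_space M) N (aug_kernel M P K G) (aug_init K G s\<^sub>0) \<pi>' H =
      distr (history_law M N P s\<^sub>0 \<pi> H) (history_space (aug_space M) N H) (augment K G H)"
    by (rule distr_history_law_augment[OF P s\<^sub>0 K G \<pi> \<pi>', symmetric]) (use eq in auto)
  then show ?thesis
    using measurable_augment[OF K G, of H N] assms
    by (simp add: integral_distr prob_algebra_measurable_eq[OF history_law_in_prob_algebra[OF P s\<^sub>0 \<pi> order_refl]])
qed

lemma reward_value_augment:
  assumes r: "\<And>t. r t \<in> bdd_measurable (M \<Otimes>\<^sub>M N)" and r\<^sub>H: "r\<^sub>H \<in> bdd_measurable M"
  shows "reward_value (aug_space M) N (aug_kernel M P K G) H (aug_reward r) (aug_terminal_reward r\<^sub>H)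
      (aug_init K G s\<^sub>0) \<pi>' = reward_value M N P H r r\<^sub>H s\<^sub>0 \<pi>"
proof -
  have "(\<lambda>h. (\<Sum>i<H. aug_reward r i (fst h i)) + aug_terminal_reward r\<^sub>H (snd h))
      \<in> borel_measurable (history_space (aug_space M) N H)"
    by (intro bdd_measurableD bdd_measurable_history_value bdd_measurable_aug_reward
        bdd_measurable_aug_terminal_reward r r\<^sub>H)
  from integral_history_law_augment[OF this] show ?thesis
    unfolding reward_value_def by (simp add: augment_def aug_reward_def aug_terminal_reward_def)
qed

lemma terminal_value_augment:
  "terminal_value (aug_space M) N (aug_kernel M P K G) H aug_constraint (aug_init K G s\<^sub>0) \<pi>' =
    reach_avoid_prob M N P H K G s\<^sub>0 \<pi>"
proof -
  let ?L = "history_law M N P s\<^sub>0 \<pi> H"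
  have sp: "space ?L = space (history_space M N H)"
    by (rule prob_algebra_space_eq[OF history_law_in_prob_algebra[OF P s\<^sub>0 \<pi> order_refl]])
  have "(\<lambda>h. aug_constraint (snd h)) \<in> borel_measurable (history_space (aug_space M) N H)"
    unfolding history_space_def
    by (rule measurable_compose[OF measurable_snd bdd_measurableD[OF bdd_measurable_aug_constraint]])
  then have "terminal_value (aug_space M) N (aug_kernel M P K G) H aug_constraint (aug_init K G s\<^sub>0) \<pi>' =
      (\<integral>h. aug_constraint (snd (augment K G H h)) \<partial>?L)"
    unfolding terminal_value_def by (rule integral_history_law_augment)
  also have "\<dots> = (\<integral>h. indicator (reach_avoid M N H K G) h \<partial>?L)"
    by (intro Bochner_Integration.integral_cong refl)
      (auto simp: aug_constraint_def augment_def flag_eq_2_iff reach_avoid_def sp)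
  also have "\<dots> = measure ?L (reach_avoid M N H K G \<inter> space ?L)" by simp
  also have "reach_avoid M N H K G \<inter> space ?L = reach_avoid M N H K G"
    unfolding sp reach_avoid_def by (intro Int_absorb2 Collect_subset)
  finally show ?thesis by (simp add: reach_avoid_prob_def)
qed

end

section \<open>Policies and optimality across the two processes\<close>

lemma strip_policy:
  assumes "\<pi> \<in> policies M N H"
  shows "(\<lambda>t h. \<pi> t (strip t h)) \<in> policies (aug_space M) N H"
  using assms unfolding policies_def by (auto intro: measurable_compose[OF measurable_strip])

text \<open>\<open>augment K G t h\<close> is itself an augmented history that ends in the required
  state. The description in \<open>markov_kernel\<close> is therefore met by some history, and the
  Markov property makes its value unique.\<close>

lemma deaugment_eq:
  assumes \<sigma>: "\<sigma> \<in> markov_policies (aug_space M) N H" and K: "K \<in> sets M" and G: "G \<in> sets M"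
    and t: "t < H" and h: "h \<in> space (history_space M N t)"
  shows "deaugment M N K G \<sigma> t h = \<sigma> t (augment K G t h)"
proof -
  have h': "augment K G t h \<in> space (history_space (aug_space M) N t)"
    by (rule measurable_space[OF measurable_augment[OF K G] h])
  have markov: "\<sigma> t h1 = \<sigma> t h2"
    if "h1 \<in> space (history_space (aug_space M) N t)" "h2 \<in> space (history_space (aug_space M) N t)"
      "snd h1 = snd h2" for h1 h2
    using \<sigma> t that unfolding markov_policies_def by blast
  have snd: "snd (augment K G t h) = (snd h, flag K G (state_at t h) t)" by (simp add: augment_def)
  show ?thesis
    unfolding deaugment_def markov_kernel_def
  proof (rule the_equality)
    show "\<forall>h''\<in>space (history_space (aug_space M) N t).
        snd h'' = (snd h, flag K G (state_at t h) t) \<longrightarrow> \<sigma> t h'' = \<sigma> t (augment K G t h)"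
      using markov[OF _ h'] unfolding snd by blast
  next
    fix \<kappa> assume "\<forall>h''\<in>space (history_space (aug_space M) N t).
        snd h'' = (snd h, flag K G (state_at t h) t) \<longrightarrow> \<sigma> t h'' = \<kappa>"
    then show "\<kappa> = \<sigma> t (augment K G t h)" using h' snd by metis
  qed
qed

text \<open>Measurability is read off the composition of \<open>\<sigma> t\<close> with
  \<open>augment\<close>; the description in \<open>markov_kernel\<close> gives no direct access to
  it.\<close>

lemma deaugment_policy:
  assumes \<sigma>: "\<sigma> \<in> markov_policies (aug_space M) N H" and K: "K \<in> sets M" and G: "G \<in> sets M"
  shows "deaugment M N K G \<sigma> \<in> policies M N H"
  unfolding policies_def
proof (intro CollectI allI impI)
  fix t assume t: "t < H"
  have "\<sigma> t \<in> history_space (aug_space M) N t \<rightarrow>\<^sub>M prob_algebra N"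
    using \<sigma> t by (simp add: markov_policies_def policies_def)
  from measurable_compose[OF measurable_augment[OF K G] this]
  show "deaugment M N K G \<sigma> t \<in> history_space M N t \<rightarrow>\<^sub>M prob_algebra N"
    by (subst measurable_cong[OF deaugment_eq[OF \<sigma> K G t]])
qed

text \<open>The supremum is taken in the reals, where it dominates the members of a set only if the
  set is bounded above.\<close>

lemma bdd_above_reward_value:
  assumes P: "P \<in> M \<Otimes>\<^sub>M N \<rightarrow>\<^sub>M prob_algebra M" and s\<^sub>0: "s\<^sub>0 \<in> space M"
    and r: "\<And>t. r t \<in> bdd_measurable (M \<Otimes>\<^sub>M N)" and r\<^sub>H: "r\<^sub>H \<in> bdd_measurable M"
  shows "bdd_above (reward_value M N P H r r\<^sub>H s\<^sub>0 ` policies M N H)"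
proof -
  note b = bdd_measurable_history_value[where r = r and t = H, OF r r\<^sub>H]
  obtain C where C: "\<And>h. h \<in> space (history_space M N H) \<Longrightarrow> \<bar>(\<Sum>i<H. r i (fst h i)) + r\<^sub>H (snd h)\<bar> \<le> C"
    using bdd_measurable_bound[OF b] by metis
  show ?thesis
  proof (rule bdd_aboveI2)
    fix \<pi> assume "\<pi> \<in> policies M N H"
    then show "reward_value M N P H r r\<^sub>H s\<^sub>0 \<pi> \<le> C"
      unfolding reward_value_def
      using prob_algebra_integral_abs_le[OF history_law_in_prob_algebra[OF P s\<^sub>0 _ order_refl] b C] by fastforce
  qed
qed

text \<open>A feasible original policy, made to ignore the flags through \<open>strip\<close>, is a
  feasible augmented policy of the same value, so it cannot beat \<open>\<sigma>\<close>; and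
  \<open>deaugment\<close> carries the reward and the constraint value of \<open>\<sigma>\<close>
  over unchanged.\<close>

lemma optimal_deaugment:
  assumes P: "P \<in> M \<Otimes>\<^sub>M N \<rightarrow>\<^sub>M prob_algebra M" and s\<^sub>0: "s\<^sub>0 \<in> space M"
    and K: "K \<in> sets M" and G: "G \<in> sets M"
    and r: "\<And>t. r t \<in> bdd_measurable (M \<Otimes>\<^sub>M N)" and r\<^sub>H: "r\<^sub>H \<in> bdd_measurable M"
    and \<sigma>: "\<sigma> \<in> markov_policies (aug_space M) N H"
    and opt: "optimal_augmented M N P H r r\<^sub>H K G \<delta> s\<^sub>0 \<sigma>"
  shows "optimal_original M N P H r r\<^sub>H K G \<delta> s\<^sub>0 (deaugment M N K G \<sigma>)"
proof -
  let ?V' = "reward_value (aug_space M) N (aug_kernel M P K G) H (aug_reward r) (aug_terminal_reward r\<^sub>H) (aug_init K G s\<^sub>0)"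
  let ?C' = "terminal_value (aug_space M) N (aug_kernel M P K G) H aug_constraint (aug_init K G s\<^sub>0)"
  let ?V = "reward_value M N P H r r\<^sub>H s\<^sub>0" and ?C = "reach_avoid_prob M N P H K G s\<^sub>0"
  let ?g = "deaugment M N K G \<sigma>"
  have \<sigma>p: "\<sigma> \<in> policies (aug_space M) N H" using \<sigma> by (simp add: markov_policies_def)
  note g = deaugment_policy[OF \<sigma> K G]
  have s': "aug_init K G s\<^sub>0 \<in> space (aug_space M)"
    using s\<^sub>0 by (auto simp: aug_init_def aug_space_def space_pair_measure flag_init_def indicator_def)
  have g_eq: "?V ?g = ?V' \<sigma>" "?C ?g = ?C' \<sigma>"
    using reward_value_augment[OF P s\<^sub>0 K G g \<sigma>p _ r r\<^sub>H] terminal_value_augment[OF P s\<^sub>0 K G g \<sigma>p]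
      deaugment_eq[OF \<sigma> K G] by simp_all
  have le: "?V \<pi> \<le> ?V ?g" if \<pi>: "\<pi> \<in> policies M N H" "\<delta> \<le> ?C \<pi>" for \<pi>
  proof -
    let ?\<pi>' = "\<lambda>t h. \<pi> t (strip t h)"
    note \<pi>' = strip_policy[OF \<pi>(1)]
    have eq: "?V' ?\<pi>' = ?V \<pi>" "?C' ?\<pi>' = ?C \<pi>"
      by (rule reward_value_augment[OF P s\<^sub>0 K G \<pi>(1) \<pi>' _ r r\<^sub>H] terminal_value_augment[OF P s\<^sub>0 K G \<pi>(1) \<pi>'];
          simp add: strip_augment)+
    have "?V' ?\<pi>' \<le> (SUP \<pi>'\<in>{\<pi>' \<in> policies (aug_space M) N H. ?C' \<pi>' \<ge> \<delta>}. ?V' \<pi>')"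
    proof (rule cSUP_upper)
      show "?\<pi>' \<in> {\<pi>' \<in> policies (aug_space M) N H. ?C' \<pi>' \<ge> \<delta>}" using \<pi>' eq(2) \<pi>(2) by simp
      have "bdd_above (?V' ` policies (aug_space M) N H)"
        by (intro bdd_above_reward_value measurable_aug_kernel bdd_measurable_aug_reward
            bdd_measurable_aug_terminal_reward P K G r r\<^sub>H s')
      then show "bdd_above (?V' ` {\<pi>' \<in> policies (aug_space M) N H. ?C' \<pi>' \<ge> \<delta>})"
        by (rule bdd_above_mono) auto
    qed
    also have "\<dots> = ?V ?g" using opt g_eq by (simp add: optimal_augmented_def constrained_optimal_def)
    finally show ?thesis using eq by simp
  qed
  have "\<delta> \<le> ?C ?g" using opt g_eq by (simp add: optimal_augmented_def constrained_optimal_def)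
  moreover from this g le have "(SUP \<pi>\<in>{\<pi> \<in> policies M N H. ?C \<pi> \<ge> \<delta>}. ?V \<pi>) = ?V ?g"
    by (intro cSup_eq_maximum) auto
  ultimately show ?thesis
    using g by (simp add: optimal_original_def constrained_optimal_def)
qed

text \<open>The flag update is in general discontinuous in the state, but setwise continuity looks
  only at measures of measurable sets, and these are pulled back to measurable sets.\<close>

lemma compact_mdp_aug:
  fixes M :: "'s measure" and A :: "'a::polish_space set"
  assumes mdp: "compact_mdp M A P" and K: "K \<in> sets M" and G: "G \<in> sets M"
  shows "compact_mdp (aug_space M) A (aug_kernel M P K G)"
proof -
  interpret compact_mdp M A P by (rule mdp)
  show ?thesis
  proof
    show "aug_kernel M P K G \<in> aug_space M \<Otimes>\<^sub>M borel_on A \<rightarrow>\<^sub>M prob_algebra (aug_space M)"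
      by (rule measurable_aug_kernel[OF P K G])
    fix x and B :: "('s \<times> nat) set" assume "x \<in> space (aug_space M)" and B: "B \<in> sets (aug_space M)"
    then obtain s y where x: "x = (s, y)" "s \<in> space M" "y \<in> {0, 1, 2}"
      by (cases x) (auto simp: aug_space_def space_pair_measure)
    let ?f = "\<lambda>s'. (s', flag_step K G s' y)"
    have f: "?f \<in> M \<rightarrow>\<^sub>M aug_space M" by (rule measurable_aug_transition[OF K G x(3)])
    have "measure (aug_kernel M P K G (x, a)) B = measure (P (s, a)) (?f -` B \<inter> space M)" if a: "a \<in> A" for a
      using measure_distr[of ?f "P (s, a)" "aug_space M" B] f B
      by (simp add: aug_kernel_def x(1) prob_algebra_measurable_eq[OF P_in[OF x(2) a]]
          prob_algebra_space_eq[OF P_in[OF x(2) a]])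
    moreover have "continuous_on A (\<lambda>a. measure (P (s, a)) (?f -` B \<inter> space M))"
      by (rule P_continuous[OF x(2) measurable_sets[OF f B]])
    ultimately show "continuous_on A (\<lambda>a. measure (aug_kernel M P K G (x, a)) B)"
      by (simp cong: continuous_on_cong)
  qed (rule compact_A A_nonempty)+
qed

lemma reward_value_cong:
  "(\<And>i. i < H \<Longrightarrow> r i = r' i) \<Longrightarrow> reward_value M N P H r r\<^sub>H s\<^sub>0 = reward_value M N P H r' r\<^sub>H s\<^sub>0"
  unfolding reward_value_def by (intro ext Bochner_Integration.integral_cong refl) simp

lemma exists_markov_optimal_augmented:
  fixes M :: "'s measure" and A :: "'a::polish_space set"
  assumes P: "P \<in> M \<Otimes>\<^sub>M borel_on A \<rightarrow>\<^sub>M prob_algebra M" and s\<^sub>0: "s\<^sub>0 \<in> space M"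
    and K: "K \<in> sets M" and G: "G \<in> sets M" and A: "compact A"
    and P_cont: "\<And>x B. x \<in> space M \<Longrightarrow> B \<in> sets M \<Longrightarrow> continuous_on A (\<lambda>a. measure (P (x, a)) B)"
    and r: "\<And>t. r t \<in> bdd_measurable (M \<Otimes>\<^sub>M borel_on A)"
    and r_cont: "\<And>t x. x \<in> space M \<Longrightarrow> continuous_on A (\<lambda>a. r t (x, a))"
    and r\<^sub>H: "r\<^sub>H \<in> bdd_measurable M"
    and \<pi>\<^sub>0: "\<pi>\<^sub>0 \<in> policies M (borel_on A) H" "0 < \<nu>"
      "\<delta> + \<nu> \<le> reach_avoid_prob M (borel_on A) P H K G s\<^sub>0 \<pi>\<^sub>0"
  shows "\<exists>\<sigma>\<in>markov_policies (aug_space M) (borel_on A) H.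
    optimal_augmented M (borel_on A) P H r r\<^sub>H K G \<delta> s\<^sub>0 \<sigma>"
proof -
  let ?\<pi> = "\<lambda>t h. \<pi>\<^sub>0 t (strip t h)"
  let ?C = "terminal_value (aug_space M) (borel_on A) (aug_kernel M P K G) H aug_constraint (aug_init K G s\<^sub>0)"
  note \<pi> = strip_policy[OF \<pi>\<^sub>0(1)]
  have feasible: "\<delta> + \<nu> \<le> ?C ?\<pi>"
    using \<pi>\<^sub>0(3) by (subst terminal_value_augment[OF P s\<^sub>0 K G \<pi>\<^sub>0(1) \<pi>]) (simp_all add: strip_augment)
  show ?thesis
  proof (cases "A = {}")
    case False
    have "compact_mdp M A P" by standard (use P A False P_cont in auto)
    then interpret aug: compact_mdp "aug_space M" A "aug_kernel M P K G"
      by (rule compact_mdp_aug[OF _ K G])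
    have "aug_reward r t \<in> aug.caratheodory" for t
    proof -
      have "continuous_on A (\<lambda>a. aug_reward r t (x, a))" if "x \<in> space (aug_space M)" for x
        using r_cont[of "fst x" t] that
        by (auto simp: aug_reward_def aug_space_def space_pair_measure split: prod.split)
      then show ?thesis
        using bdd_measurable_aug_reward[where r = r, OF r] by (simp add: aug.caratheodory_def)
    qed
    moreover have "aug_init K G s\<^sub>0 \<in> space (aug_space M)"
      using s\<^sub>0 by (auto simp: aug_init_def aug_space_def space_pair_measure flag_init_def indicator_def)
    moreover have "aug_constraint x \<in> {0..1}" for x :: "'s \<times> nat"
      by (auto simp: aug_constraint_def split: prod.split)
    ultimately show ?thesis
      unfolding optimal_augmented_def
      by (intro aug.exists_markov_constrained_optimal[OF _ bdd_measurable_aug_terminal_reward[OF r\<^sub>H]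
            bdd_measurable_aug_constraint _ _ \<pi> \<pi>\<^sub>0(2) feasible])
  next
    case True
    \<comment> \<open>An empty action set carries no probability measure, so the existence of the
      given policy forces a horizon without decisions; then all policies have the same law.\<close>
    have "\<not> 0 < H"
    proof
      assume "0 < H"
      have "(\<lambda>_. undefined, s\<^sub>0) \<in> space (history_space M (borel_on A) 0)"
        using s\<^sub>0 by (simp add: history_space_def space_pair_measure space_PiM)
      note \<mu> = policy_in_prob_algebra[OF \<pi>\<^sub>0(1) \<open>0 < H\<close> this]
      then have "space (\<pi>\<^sub>0 0 (\<lambda>_. undefined, s\<^sub>0)) \<noteq> {}"
        by (simp add: space_prob_algebra prob_space.not_empty)
      then show False using True by (simp add: prob_algebra_space_eq[OF \<mu>] space_restrict_space)
    qed
    then have [simp]: "H = 0" by simp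
    have "?\<pi> \<in> markov_policies (aug_space M) (borel_on A) H"
      using \<pi> by (simp add: markov_policies_def)
    moreover have "{\<pi> \<in> policies (aug_space M) (borel_on A) H. ?C \<pi> \<ge> \<delta>} \<noteq> {}"
      using \<pi> feasible \<pi>\<^sub>0(2) by auto
    ultimately show ?thesis
      using \<pi> feasible \<pi>\<^sub>0(2)
      by (intro bexI[of _ ?\<pi>]) (auto simp: optimal_augmented_def constrained_optimal_def reward_value_def)
  qed
qed

theorem theorem3p2:
  fixes S :: "'s::polish_space set" and A :: "'a::polish_space set"
    and H :: nat
    and P :: "'s \<times> 'a \<Rightarrow> 's measure"
    and r :: "nat \<Rightarrow> 's \<times> 'a \<Rightarrow> real" and r\<^sub>H :: "'s \<Rightarrow> real"
    and s\<^sub>0 :: 's and K G :: "'s set" and \<delta> \<nu> :: real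
    and \<pi>\<^sub>0 :: "('s, 'a) policy"
  assumes "S \<in> sets borel" and "A \<in> sets borel"
    and "P \<in> borel_on S \<Otimes>\<^sub>M borel_on A \<rightarrow>\<^sub>M prob_algebra (borel_on S)"
    and "\<forall>t<H. r t \<in> borel_on S \<Otimes>\<^sub>M borel_on A \<rightarrow>\<^sub>M borel_on {0..1}"
    and "r\<^sub>H \<in> borel_on S \<rightarrow>\<^sub>M borel_on {0..1}"
    and "s\<^sub>0 \<in> S"
    and "K \<in> sets (borel_on S)" and "G \<in> sets (borel_on S)" and "G \<subseteq> K"
    and "0 \<le> \<delta>" and "\<delta> < 1"
    and compact_actions: "compact A"
    and continuous_kernel:
      "\<forall>s\<in>S. \<forall>B\<in>sets (borel_on S). continuous_on A (\<lambda>a. measure (P (s, a)) B)"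
    and continuous_rewards: "\<forall>s\<in>S. \<forall>t<H. continuous_on A (\<lambda>a. r t (s, a))"
    and slater: "\<pi>\<^sub>0 \<in> policies (borel_on S) (borel_on A) H" "0 < \<nu>"
      "reach_avoid_prob (borel_on S) (borel_on A) P H K G s\<^sub>0 \<pi>\<^sub>0 \<ge> \<delta> + \<nu>"
  shows "\<exists>\<pi>\<^sub>M \<in> markov_policies (aug_space (borel_on S)) (borel_on A) H.
     optimal_augmented (borel_on S) (borel_on A) P H r r\<^sub>H K G \<delta> s\<^sub>0 \<pi>\<^sub>M \<and>
     optimal_original (borel_on S) (borel_on A) P H r r\<^sub>H K G \<delta> s\<^sub>0
       (deaugment (borel_on S) (borel_on A) K G \<pi>\<^sub>M)"
proof -
  let ?M = "borel_on S" and ?N = "borel_on A"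
  have space: "space ?M = S" "space ?N = A" by (simp_all add: space_restrict_space)
  note P = assms(3) and K = assms(7) and G = assms(8)
  have s\<^sub>0: "s\<^sub>0 \<in> space ?M" using assms(6) space by simp
  \<comment> \<open>The hypotheses concern times before \<open>H\<close>, while the general results
    ask for a reward at every index; setting it to zero from \<open>H\<close> on changes no
    value.\<close>
  define r' where "r' t = (if t < H then r t else (\<lambda>_. 0))" for t
  have r': "r' t \<in> bdd_measurable (?M \<Otimes>\<^sub>M ?N)" for t
    unfolding r'_def using assms(4) by (cases "t < H") (auto intro: bdd_measurable_unit bdd_measurable_const)
  have r\<^sub>H: "r\<^sub>H \<in> bdd_measurable ?M" by (rule bdd_measurable_unit[OF assms(5)])
  have r'_cont: "continuous_on A (\<lambda>a. r' t (x, a))" if "x \<in> space ?M" for t x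
    using continuous_rewards that space by (simp add: r'_def)
  have P_cont: "continuous_on A (\<lambda>a. measure (P (x, a)) B)" if "x \<in> space ?M" "B \<in> sets ?M" for x B
    using continuous_kernel that space by auto
  have "\<exists>\<sigma>\<in>markov_policies (aug_space ?M) ?N H. optimal_augmented ?M ?N P H r' r\<^sub>H K G \<delta> s\<^sub>0 \<sigma>"
    by (rule exists_markov_optimal_augmented[OF P s\<^sub>0 K G compact_actions _ r' _ r\<^sub>H slater])
      (rule P_cont r'_cont; assumption)+
  then obtain \<sigma> where \<sigma>: "\<sigma> \<in> markov_policies (aug_space ?M) ?N H"
    "optimal_augmented ?M ?N P H r' r\<^sub>H K G \<delta> s\<^sub>0 \<sigma>" by (elim bexE)
  have "optimal_original ?M ?N P H r' r\<^sub>H K G \<delta> s\<^sub>0 (deaugment ?M ?N K G \<sigma>)"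
    by (rule optimal_deaugment[OF P s\<^sub>0 K G r' r\<^sub>H \<sigma>])
  moreover have "optimal_original ?M ?N P H r' = optimal_original ?M ?N P H r"
    "optimal_augmented ?M ?N P H r' = optimal_augmented ?M ?N P H r"
    unfolding optimal_original_def[abs_def] optimal_augmented_def[abs_def]
    using reward_value_cong[of H r' r] reward_value_cong[of H "aug_reward r'" "aug_reward r"]
    by (simp_all add: r'_def aug_reward_def)
  ultimately show ?thesis using \<sigma> by (intro bexI[of _ \<sigma>]) simp_all
qed

end
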